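(* Let $\alpha>0$. Then the algorithm PC1 (defined in the context) is unconditionally well-posed for any input $\boldsymbol{m}_h^0\in\boldsymbol{\mathcal{M}}_h$, i.e., for all $\ell=0,\dots,L-1$, the predictor problem admits a unique solution $\boldsymbol{v}_h^\ell\in\mathcal{S}^1(\mathcal{T}_h)^3$, and the corrector is well-posed (i.e., the denominators appearing in it do not vanish), providing $\boldsymbol{m}_h^{\ell+1}\in\boldsymbol{\mathcal{M}}_h$.
   Context: **Setting.** $\Omega\subset\mathbb{R}^3$ is a bounded Lipschitz domain with a regular (conforming) tetrahedral triangulation $\mathcal{T}_h$ of mesh size $h>0$; $\mathcal{N}_h$ is the set of vertices of $\mathcal{T}_h$. $T>0$, $L\in\mathbb{N}$, $k:=T/L>0$ is the uniform time-step size. $\alpha\ge 0$ (damping), $\ell_{\mathrm{ex}}>0$ (exchange length), $\theta\in[0,1]$ are constants. $\times$ is the cross product and $\cdot$ the scalar product in $\mathbb{R}^3$, $|\cdot|$ the Euclidean norm, $\mathbb{S}^2$ the unit sphere in $\mathbb{R}^3$. **Discrete spaces.** $\mathcal{S}^1(\mathcal{T}_h)$ is the space of $\mathcal{T}_h$-piecewise linear, globally continuous functions $\overline\Omega\to\mathbb{R}$, with nodal basis $\{\phi_{\boldsymbol z}\}_{\boldsymbol z\in\mathcal{N}_h}$, $\phi_{\boldsymbol z}(\boldsymbol z')=\delta_{\boldsymbol z,\boldsymbol z'}$. Set $$\boldsymbol{\mathcal{M}}_h:=\{\boldsymbol m_h\in\mathcal{S}^1(\mathcal{T}_h)^3:\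 |\boldsymbol m_h(\boldsymbol z)|=1\ \text{for all }\boldsymbol z\in\mathcal{N}_h\}.$$ **Mass-lumped product.** For continuous $\boldsymbol u,\boldsymbol w:\overline\Omega\to\mathbb{R}^3$, $$\langle\boldsymbol u,\boldsymbol w\rangle_h:=\sum_{\boldsymbol z\in\mathcal{N}_h}\beta_{\boldsymbol z}\,\boldsymbol u(\boldsymbol z)\cdot\boldsymbol w(\boldsymbol z),\qquad \beta_{\boldsymbol z}:=\int_\Omega\phi_{\boldsymbol z}\,d\boldsymbol x>0$$ (equivalently, the integral over $\Omega$ of the nodal interpolant of $\boldsymbol u\cdot\boldsymbol w$). $\langle\cdot,\cdot\rangle$ is the $L^2(\Omega)$-scalar product (for vector- or matrix-valued functions). **Discrete Laplacian.** For $\boldsymbol w\in H^1(\Omega;\mathbb{R}^3)$, $\boldsymbol\Delta_h\boldsymbol w\in\mathcal{S}^1(\mathcal{T}_h)^3$ is the unique function with $-\langle\boldsymbol\Delta_h\boldsymbol w,\boldsymbol w_h\rangle_h=\langle\nabla\boldsymbol w,\nabla\boldsymbol w_h\rangle$ for all $\boldsymbol w_h\in\mathcal{S}^1(\mathcal{T}_h)^3$. **Algorithm PC1.** Input $\boldsymbol m_h^0\in\boldsymbol{\mathcal{M}}_h$. For $\ell=0,\dots,L-1$: (i) Predictor: compute $\boldsymbol v_h^\ell\in\mathcal{S}^1(\mathcal{T}_h)^3$ such that, for all $\boldsymbol w_h\in\mathcal{S}^1(\mathcal{T}_h)^3$, $$(1+\alpha^2)\langle\boldsymbol v_h^\ell,\boldsymbol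 w_h\rangle_h=-\ell_{\mathrm{ex}}^2\langle\boldsymbol m_h^\ell\times\boldsymbol\Delta_h(\boldsymbol m_h^\ell+\theta k\boldsymbol v_h^\ell),\boldsymbol w_h\rangle_h-\alpha\ell_{\mathrm{ex}}^2\langle\boldsymbol m_h^\ell\times(\boldsymbol m_h^\ell\times\boldsymbol\Delta_h(\boldsymbol m_h^\ell+\theta k\boldsymbol v_h^\ell)),\boldsymbol w_h\rangle_h.$$ (ii) Corrector: define $\boldsymbol m_h^{\ell+1}\in\boldsymbol{\mathcal{M}}_h$ by $$\boldsymbol m_h^{\ell+1}(\boldsymbol z):=\frac{\boldsymbol m_h^\ell(\boldsymbol z)+k\boldsymbol v_h^\ell(\boldsymbol z)}{|\boldsymbol m_h^\ell(\boldsymbol z)+k\boldsymbol v_h^\ell(\boldsymbol z)|}\in\mathbb{S}^2\quad\text{for all }\boldsymbol z\in\mathcal{N}_h.$$ *)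

theory Defs
  imports "HOL-Analysis.Analysis"
begin

section \<open>Domain and triangulation\<close>

text \<open>
  Near each boundary point the domain is, in suitable orthonormal coordinates, the set strictly
  above the graph of a Lipschitz function of the first two coordinates.
\<close>

definition lipschitz_boundary :: "(real^3) set \<Rightarrow> bool" where
  "lipschitz_boundary \<Omega> \<longleftrightarrow>
     (\<forall>x \<in> frontier \<Omega>. \<exists>r > 0. \<exists>(Q :: real^3 \<Rightarrow> real^3) (\<gamma> :: real \<times> real \<Rightarrow> real) C.
        orthogonal_transformation Q \<and> C-lipschitz_on UNIV \<gamma> \<and>
        \<Omega> \<inter> ball x r = {y \<in> ball x r. \<gamma> (Q y $ 1, Q y $ 2) < Q y $ 3})"

definition bounded_lipschitz_domain :: "(real^3) set \<Rightarrow> bool" where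
  "bounded_lipschitz_domain \<Omega> \<longleftrightarrow>
     open \<Omega> \<and> connected \<Omega> \<and> \<Omega> \<noteq> {} \<and> bounded \<Omega> \<and> lipschitz_boundary \<Omega>"

text \<open>
  The library's \<^const>\<open>triangulation\<close> is finite and conforming: any two of its simplices meet in a
  common (possibly empty) face.
\<close>

definition tetrahedral_triangulation :: "(real^3) set \<Rightarrow> (real^3) set set \<Rightarrow> bool" where
  "tetrahedral_triangulation \<Omega> \<T> \<longleftrightarrow>
     triangulation \<T> \<and> (\<forall>K \<in> \<T>. 3 simplex K) \<and> \<Union>\<T> = closure \<Omega>"

definition mesh_size :: "(real^3) set set \<Rightarrow> real" where
  "mesh_size \<T> = Max (diameter ` \<T>)"

definition nodes :: "(real^3) set set \<Rightarrow> (real^3) set" where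
  "nodes \<T> = {z. \<exists>K \<in> \<T>. z extreme_point_of K}"


section \<open>Discrete spaces\<close>

text \<open>
  Functions on \<open>closure \<Omega>\<close> are represented by total functions. Members of the finite element spaces
  are normalised to vanish outside \<open>closure \<Omega>\<close>, so that equality of total functions is
  equality on \<open>closure \<Omega>\<close>.
\<close>

definition P1 :: "(real^3) set \<Rightarrow> (real^3) set set \<Rightarrow> (real^3 \<Rightarrow> real) set" where
  "P1 \<Omega> \<T> = {u. continuous_on (closure \<Omega>) u \<and>
                 (\<forall>K \<in> \<T>. \<exists>a b. \<forall>x \<in> K. u x = a \<bullet> x + b) \<and>
                 (\<forall>x. x \<notin> closure \<Omega> \<longrightarrow> u x = 0)}"

definition P1_vec :: "(real^3) set \<Rightarrow> (real^3) set set \<Rightarrow> (real^3 \<Rightarrow> real^3) set" where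
  "P1_vec \<Omega> \<T> = {u. \<forall>i. (\<lambda>x. u x $ i) \<in> P1 \<Omega> \<T>}"

definition nodal_basis :: "(real^3) set \<Rightarrow> (real^3) set set \<Rightarrow> real^3 \<Rightarrow> real^3 \<Rightarrow> real" where
  "nodal_basis \<Omega> \<T> z =
     (THE \<phi>. \<phi> \<in> P1 \<Omega> \<T> \<and> (\<forall>z' \<in> nodes \<T>. \<phi> z' = (if z' = z then 1 else 0)))"

definition unit_P1_vec :: "(real^3) set \<Rightarrow> (real^3) set set \<Rightarrow> (real^3 \<Rightarrow> real^3) set" where
  "unit_P1_vec \<Omega> \<T> = {m \<in> P1_vec \<Omega> \<T>. \<forall>z \<in> nodes \<T>. norm (m z) = 1}"

definition node_weight :: "(real^3) set \<Rightarrow> (real^3) set set \<Rightarrow> real^3 \<Rightarrow> real" where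
  "node_weight \<Omega> \<T> z = (LINT x:\<Omega>|lebesgue. nodal_basis \<Omega> \<T> z x)"

definition lumped_inner ::
  "(real^3) set \<Rightarrow> (real^3) set set \<Rightarrow> (real^3 \<Rightarrow> real^3) \<Rightarrow> (real^3 \<Rightarrow> real^3) \<Rightarrow> real" where
  "lumped_inner \<Omega> \<T> u w = (\<Sum>z \<in> nodes \<T>. node_weight \<Omega> \<T> z * (u z \<bullet> w z))"


section \<open>Sobolev space and discrete Laplacian\<close>

definition square_integrable :: "(real^3) set \<Rightarrow> (real^3 \<Rightarrow> 'b::euclidean_space) \<Rightarrow> bool" where
  "square_integrable \<Omega> f \<longleftrightarrow>
     set_borel_measurable lebesgue \<Omega> f \<and> set_integrable lebesgue \<Omega> (\<lambda>x. (norm (f x))\<^sup>2)"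

definition L2_inner ::
  "(real^3) set \<Rightarrow> (real^3 \<Rightarrow> 'b::euclidean_space) \<Rightarrow> (real^3 \<Rightarrow> 'b) \<Rightarrow> real" where
  "L2_inner \<Omega> f g = (LINT x:\<Omega>|lebesgue. f x \<bullet> g x)"

text \<open>\<open>\<psi>\<close> is in \<open>C\<^sup>1\<close> with compact support in \<open>\<Omega>\<close>, and \<open>D\<psi>\<close> is its gradient.\<close>

definition test_function ::
  "(real^3) set \<Rightarrow> (real^3 \<Rightarrow> real) \<Rightarrow> (real^3 \<Rightarrow> real^3) \<Rightarrow> bool" where
  "test_function \<Omega> \<psi> D\<psi> \<longleftrightarrow>
     (\<forall>x. GDERIV \<psi> x :> D\<psi> x) \<and> continuous_on UNIV D\<psi> \<and>
     compact (closure {x. \<psi> x \<noteq> 0}) \<and> closure {x. \<psi> x \<noteq> 0} \<subseteq> \<Omega>"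

text \<open>
  Row \<open>i\<close> of the matrix field \<open>G\<close> is the weak gradient of the \<open>i\<close>-th component of \<open>w\<close>. The inner
  product on \<^typ>\<open>real^3^3\<close> is the Frobenius product, so \<^const>\<open>L2_inner\<close> applies to such fields.
\<close>

definition has_weak_gradient ::
  "(real^3) set \<Rightarrow> (real^3 \<Rightarrow> real^3) \<Rightarrow> (real^3 \<Rightarrow> real^3^3) \<Rightarrow> bool" where
  "has_weak_gradient \<Omega> w G \<longleftrightarrow>
     square_integrable \<Omega> w \<and> square_integrable \<Omega> G \<and>
     (\<forall>\<psi> D\<psi>. test_function \<Omega> \<psi> D\<psi> \<longrightarrow>
        (\<forall>i. (LINT x:\<Omega>|lebesgue. (w x $ i) *\<^sub>R D\<psi> x) = - (LINT x:\<Omega>|lebesgue. \<psi> x *\<^sub>R (G x $ i))))"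

definition H1_vec :: "(real^3) set \<Rightarrow> (real^3 \<Rightarrow> real^3) set" where
  "H1_vec \<Omega> = {w. \<exists>G. has_weak_gradient \<Omega> w G}"

text \<open>
  The weak gradient is determined only up to null sets (and arbitrary outside \<open>\<Omega>\<close>); some
  representative is chosen. It is meaningful for \<open>w \<in> H1_vec \<Omega>\<close>.
\<close>

definition weak_gradient :: "(real^3) set \<Rightarrow> (real^3 \<Rightarrow> real^3) \<Rightarrow> real^3 \<Rightarrow> real^3^3" where
  "weak_gradient \<Omega> w = (SOME G. has_weak_gradient \<Omega> w G)"

text \<open>As with the weak gradient, the argument \<open>w\<close> is meant to range over \<open>H1_vec \<Omega>\<close>.\<close>

definition discrete_laplacian ::
  "(real^3) set \<Rightarrow> (real^3) set set \<Rightarrow> (real^3 \<Rightarrow> real^3) \<Rightarrow> real^3 \<Rightarrow> real^3" where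
  "discrete_laplacian \<Omega> \<T> w =
     (THE D. D \<in> P1_vec \<Omega> \<T> \<and>
        (\<forall>u \<in> P1_vec \<Omega> \<T>.
           - lumped_inner \<Omega> \<T> D u = L2_inner \<Omega> (weak_gradient \<Omega> w) (weak_gradient \<Omega> u)))"


section \<open>Algorithm PC1\<close>

text \<open>\<open>v\<close> solves the predictor problem for the current iterate \<open>m\<close>.\<close>

definition PC1_predictor ::
  "(real^3) set \<Rightarrow> (real^3) set set \<Rightarrow> real \<Rightarrow> real \<Rightarrow> real \<Rightarrow> real \<Rightarrow>
     (real^3 \<Rightarrow> real^3) \<Rightarrow> (real^3 \<Rightarrow> real^3) \<Rightarrow> bool" where
  "PC1_predictor \<Omega> \<T> \<alpha> l\<^sub>e\<^sub>x \<theta> k m v \<longleftrightarrow>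
     v \<in> P1_vec \<Omega> \<T> \<and>
     (let H = discrete_laplacian \<Omega> \<T> (\<lambda>x. m x + (\<theta> * k) *\<^sub>R v x) in
      \<forall>w \<in> P1_vec \<Omega> \<T>.
        (1 + \<alpha>\<^sup>2) * lumped_inner \<Omega> \<T> v w =
          - l\<^sub>e\<^sub>x\<^sup>2 * lumped_inner \<Omega> \<T> (\<lambda>x. cross3 (m x) (H x)) w
          - \<alpha> * l\<^sub>e\<^sub>x\<^sup>2 * lumped_inner \<Omega> \<T> (\<lambda>x. cross3 (m x) (cross3 (m x) (H x))) w)"

text \<open>
  \<open>m'\<close> is the new iterate. This is only meaningful if the denominators do not vanish (division by
  zero is totalised), which has to be required separately.
\<close>

definition PC1_corrector ::
  "(real^3) set \<Rightarrow> (real^3) set set \<Rightarrow> real \<Rightarrow>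
     (real^3 \<Rightarrow> real^3) \<Rightarrow> (real^3 \<Rightarrow> real^3) \<Rightarrow> (real^3 \<Rightarrow> real^3) \<Rightarrow> bool" where
  "PC1_corrector \<Omega> \<T> k m v m' \<longleftrightarrow>
     m' \<in> unit_P1_vec \<Omega> \<T> \<and>
     (\<forall>z \<in> nodes \<T>. m' z = (m z + k *\<^sub>R v z) /\<^sub>R norm (m z + k *\<^sub>R v z))"

end

(* Testing the predictor equation with nodal basis functions makes it equivalent to one vector
   equation per vertex. It forces v to be tangential, m . v = 0, and for the homogeneous problem,
   with c = l^2 and H = theta k Delta_h v, it yields alpha |v|^2 = c H . v at each vertex. Summing
   with the positive weights beta_z gives
     alpha <v,v>_h = l^2 theta k <Delta_h v, v>_h = - l^2 theta k |grad v|^2 <= 0,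
   so v = 0: the problem is a square linear system with trivial kernel. Tangentiality gives
   |m + k v|^2 = 1 + k^2 |v|^2 >= 1 for the corrector.

   The discrete Laplacian of the definitions is built from arbitrarily chosen weak gradients. That the
   resulting form is bilinear on the finite element space uses that continuous piecewise linear
   functions have weak gradients and that weak gradients are unique almost everywhere. *)
theory Submission
  imports Defs
begin

section \<open>Finite linear systems\<close>

text \<open>The operator v -> m x Delta_h v has no sign of its own, so the cross products are
  eliminated at each node before summing; the energy then controls v through the factor \<alpha>,
  and this is where damping enters. Two devices shape the analytic part. Integration by parts for
  piecewise linear functions uses difference quotients instead of the divergence theorem on each
  tetrahedron, so no face fluxes have to be cancelled. Uniqueness of weak gradients uses no
  mollification: explicit C^1 functions approximate the indicators of open boxes, and boxes generate
  the Borel sets. The finite element space is a set of functions rather than a type, so linear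
  algebra is done in coordinates indexed by pairs of a node and a component.\<close>

lemma square_system_solvable:
  fixes a :: "'r \<Rightarrow> 'c \<Rightarrow> 'f::field"
  assumes "finite C" "finite R" "card R = card C"
    and "\<And>x. (\<forall>r\<in>R. (\<Sum>c\<in>C. a r c * x c) = 0) \<Longrightarrow> \<forall>c\<in>C. x c = 0"
  shows "\<exists>x. \<forall>r\<in>R. (\<Sum>c\<in>C. a r c * x c) = b r"
  using assms
proof (induction C arbitrary: R a b rule: finite_induct)
  case empty
  then show ?case by simp
next
  case (insert c C)
  have sum_upd: "(\<Sum>t\<in>insert c C. f t * (x(c := y)) t) = f c * y + (\<Sum>t\<in>C. f t * x t)"
    for f x and y :: 'f
    using insert.hyps by (auto intro!: sum.cong)
  \<comment> \<open>A pivot exists: if column \<open>c\<close> vanished on \<open>R\<close>, the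
    unit vector at \<open>c\<close> would be a nonzero kernel vector.\<close>
  obtain p where p: "p \<in> R" "a p c \<noteq> 0"
  proof (rule ccontr)
    assume "\<not> thesis"
    with that have "\<forall>r\<in>R. a r c = 0" by blast
    then have "\<forall>r\<in>R. (\<Sum>t\<in>insert c C. a r t * ((\<lambda>_. 0)(c := 1)) t) = 0"
      by (subst sum_upd) simp
    from insert.prems(3)[OF this] show False by simp
  qed
  \<comment> \<open>One step of Gaussian elimination: subtracting a multiple of row \<open>p\<close>
    clears column \<open>c\<close>. Rows and columns carry unrelated index sets, so \<open>p\<close>
    and \<open>c\<close> can be removed independently.\<close>
  define a' where "a' r t = a r t - a r c * a p t / a p c" for r t
  have a': "(\<Sum>t\<in>C. a' r t * x t) = (\<Sum>t\<in>C. a r t * x t) - a r c / a p c * (\<Sum>t\<in>C. a p t * x t)" for r x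
    by (simp add: a'_def algebra_simps sum_subtractf sum_distrib_left divide_inverse)
  have "\<exists>x. \<forall>r\<in>R - {p}. (\<Sum>t\<in>C. a' r t * x t) = b r - a r c * b p / a p c"
  proof (rule insert.IH)
    show "finite (R - {p})" "card (R - {p}) = card C"
      using insert.prems insert.hyps p by auto
    fix x assume x: "\<forall>r\<in>R - {p}. (\<Sum>t\<in>C. a' r t * x t) = 0"
    \<comment> \<open>Solving row \<open>p\<close> for the entry at \<open>c\<close> extends a
      kernel vector of the reduced system to one of the full system.\<close>
    let ?x = "x(c := - (\<Sum>t\<in>C. a p t * x t) / a p c)"
    have "(\<Sum>t\<in>insert c C. a r t * ?x t) = 0" if "r \<in> R" for r
      using x that p by (cases "r = p") (auto simp only: sum_upd a', auto simp: field_simps)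
    then have "\<forall>t\<in>insert c C. ?x t = 0" using insert.prems(3) by blast
    then show "\<forall>t\<in>C. x t = 0" using insert.hyps by (metis fun_upd_other insertCI)
  qed
  then obtain x where x: "\<forall>r\<in>R - {p}. (\<Sum>t\<in>C. a' r t * x t) = b r - a r c * b p / a p c" ..
  let ?x = "x(c := (b p - (\<Sum>t\<in>C. a p t * x t)) / a p c)"
  have "(\<Sum>t\<in>insert c C. a r t * ?x t) = b r" if "r \<in> R" for r
    using x that p by (cases "r = p") (auto simp only: sum_upd a', auto simp: field_simps)
  then show ?case by blast
qed

text \<open>A matrix is read off from the unit vectors \<open>e t\<close>. Since \<open>F\<close>
  acts on functions on the whole type, \<open>cong\<close> is what guarantees that the values
  outside \<open>S\<close> do not matter.\<close>

lemma linear_inj_imp_surj_on_finite: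
  fixes F :: "('s \<Rightarrow> 'f::field) \<Rightarrow> 's \<Rightarrow> 'f"
  assumes S: "finite S"
    and add: "\<And>x y s. s \<in> S \<Longrightarrow> F (\<lambda>t. x t + y t) s = F x s + F y s"
    and scale: "\<And>c x s. s \<in> S \<Longrightarrow> F (\<lambda>t. c * x t) s = c * F x s"
    and cong: "\<And>x y s. s \<in> S \<Longrightarrow> (\<And>t. t \<in> S \<Longrightarrow> x t = y t) \<Longrightarrow> F x s = F y s"
    and inj: "\<And>x. (\<And>s. s \<in> S \<Longrightarrow> F x s = 0) \<Longrightarrow> \<forall>s\<in>S. x s = 0"
  shows "\<exists>x. \<forall>s\<in>S. F x s = b s"
proof -
  define e where "e t = (\<lambda>s. if s = t then 1 else 0 :: 'f)" for t :: 's
  have zero: "F (\<lambda>_. 0) s = 0" if "s \<in> S" for s using scale[OF that, of 0 "\<lambda>_. 0"] by simp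
  have sum: "F (\<lambda>s. \<Sum>t\<in>A. x t * e t s) s = (\<Sum>t\<in>A. F (e t) s * x t)"
    if "finite A" "s \<in> S" for A x s
    using that by (induction A) (simp_all add: zero add scale mult.commute)
  have F: "F x s = (\<Sum>t\<in>S. F (e t) s * x t)" if "s \<in> S" for x s
  proof -
    have "F x s = F (\<lambda>s. \<Sum>t\<in>S. x t * e t s) s"
      using that S by (intro cong) (auto simp: e_def if_distrib cong: if_cong)
    then show ?thesis using sum[OF S that] by simp
  qed
  have "\<exists>x. \<forall>s\<in>S. (\<Sum>t\<in>S. F (e t) s * x t) = b s"
    using S inj by (intro square_system_solvable) (auto simp flip: F)
  then show ?thesis by (simp flip: F)
qed

section \<open>Nodal interpolation on a tetrahedral mesh\<close>

text \<open>After moving one point \<open>c\<close> to the origin the other points are linearly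
  independent, so the differences of \<open>g\<close> extend to a linear functional
  \<open>f\<close>; \<open>adjoint f 1\<close> is its Riesz representative.\<close>

lemma affine_interpolation:
  fixes g :: "'a::euclidean_space \<Rightarrow> real"
  assumes "\<not> affine_dependent C"
  shows "\<exists>a b. \<forall>z\<in>C. a \<bullet> z + b = g z"
proof (cases "C = {}")
  case False
  then obtain c where c: "c \<in> C" by auto
  have "independent ((\<lambda>x. - c + x) ` (C - {c}))"
    using assms affine_dependent_iff_dependent2[OF c] by simp
  from linear_independent_extend[OF this, of "\<lambda>x. g (c + x) - g c"]
  obtain f :: "'a \<Rightarrow> real" where f: "linear f"
    "\<And>z. z \<in> C - {c} \<Longrightarrow> f (- c + z) = g z - g c"
    by force
  have "adjoint f 1 \<bullet> z + (g c - adjoint f 1 \<bullet> c) = g z" if "z \<in> C" for z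
  proof -
    have "f x = adjoint f 1 \<bullet> x" for x
      using adjoint_works[OF f(1), of x 1] by (simp add: inner_commute)
    moreover have "f (- c + z) = g z - g c"
      using f that linear_0[OF f(1)] by (cases "z = c") auto
    ultimately show ?thesis by (simp add: inner_right_distrib inner_diff_right)
  qed
  then show ?thesis by blast
qed auto

lemma affine_eq_on_convex_hull:
  fixes a a' :: "'a::euclidean_space"
  assumes "\<And>z. z \<in> S \<Longrightarrow> a \<bullet> z + b = a' \<bullet> z + b'" and "x \<in> convex hull S"
  shows "a \<bullet> x + b = a' \<bullet> x + b'"
proof -
  have "convex hull S \<subseteq> {x. (a - a') \<bullet> x = b' - b}"
    using assms(1) by (intro hull_minimal convex_hyperplane) (force simp: inner_diff_left)
  then show ?thesis using assms(2) by (force simp: inner_diff_left)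
qed

section \<open>Piecewise linear functions on a conforming mesh and their nodal values\<close>

locale tetrahedral_mesh =
  fixes \<Omega> :: "(real^3) set" and \<T> :: "(real^3) set set"
  assumes domain: "bounded_lipschitz_domain \<Omega>"
    and mesh: "tetrahedral_triangulation \<Omega> \<T>"
begin

abbreviation "\<N> \<equiv> nodes \<T>"

lemma open_domain: "open \<Omega>" and bounded_domain: "bounded \<Omega>"
  using domain by (auto simp: bounded_lipschitz_domain_def)

lemma finite_mesh: "finite \<T>" and Union_mesh: "\<Union>\<T> = closure \<Omega>"
  using mesh by (auto simp: tetrahedral_triangulation_def triangulation_def)

lemma mesh_simplex: "K \<in> \<T> \<Longrightarrow> 3 simplex K"
  using mesh by (auto simp: tetrahedral_triangulation_def)

lemma mesh_Int_face: "K \<in> \<T> \<Longrightarrow> K' \<in> \<T> \<Longrightarrow> (K \<inter> K') face_of K"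
  using mesh by (auto simp: tetrahedral_triangulation_def triangulation_def)

lemma
  assumes "K \<in> \<T>"
  shows convex_element: "convex K" and compact_element: "compact K"
  using mesh_simplex[OF assms] by (auto simp: simplex intro: finite_imp_compact_convex_hull)

text \<open>Links the two descriptions of a vertex: nodes are defined as extreme points, simplices
  as hulls of affinely independent points.\<close>

lemma element_vertices:
  assumes "K \<in> \<T>"
  obtains C where "\<not> affine_dependent C" "finite C" "K = convex hull C" "C \<subseteq> \<N>"
    "\<And>z. z extreme_point_of K \<longleftrightarrow> z \<in> C"
proof -
  obtain C where C: "finite C" "\<not> affine_dependent C" "int (card C) = 3 + 1" "K = convex hull C"
    using mesh_simplex[OF assms] by (auto simp: simplex)
  show thesis
  proof
    show ext: "z extreme_point_of K \<longleftrightarrow> z \<in> C" for z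
      using C extreme_point_of_convex_hull_affine_independent by blast
    then show "C \<subseteq> \<N>" using assms by (auto simp: nodes_def)
  qed (use C in auto)
qed

lemma finite_nodes: "finite \<N>"
proof -
  have "finite {z. z extreme_point_of K}" if "K \<in> \<T>" for K
    by (rule element_vertices[OF that]) simp
  moreover have "\<N> = (\<Union>K\<in>\<T>. {z. z extreme_point_of K})" by (auto simp: nodes_def)
  ultimately show ?thesis using finite_mesh by simp
qed

lemma nodes_subset: "\<N> \<subseteq> closure \<Omega>"
  using Union_mesh by (force simp: nodes_def extreme_point_of_def)

lemma P1_affineE:
  assumes "u \<in> P1 \<Omega> \<T>" "K \<in> \<T>"
  obtains a b where "\<And>x. x \<in> K \<Longrightarrow> u x = a \<bullet> x + b"
  using assms by (auto simp: P1_def)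

lemma P1_outside: "u \<in> P1 \<Omega> \<T> \<Longrightarrow> x \<notin> closure \<Omega> \<Longrightarrow> u x = 0"
  by (simp add: P1_def)

text \<open>On each tetrahedron an affine function is determined by its vertex values. Outside the
  closed domain both functions vanish by normalisation, hence equality of total functions.\<close>

lemma P1_eqI:
  assumes u: "u \<in> P1 \<Omega> \<T>" and w: "w \<in> P1 \<Omega> \<T>" and eq: "\<And>z. z \<in> \<N> \<Longrightarrow> u z = w z"
  shows "u = w"
proof
  fix x
  show "u x = w x"
  proof (cases "x \<in> closure \<Omega>")
    case True
    then obtain K where K: "K \<in> \<T>" "x \<in> K" using Union_mesh by auto
    obtain C where C: "K = convex hull C" "C \<subseteq> \<N>" using element_vertices[OF K(1)] .
    obtain a b where a: "\<And>x. x \<in> K \<Longrightarrow> u x = a \<bullet> x + b" using P1_affineE[OF u K(1)] by blast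
    obtain a' b' where a': "\<And>x. x \<in> K \<Longrightarrow> w x = a' \<bullet> x + b'" using P1_affineE[OF w K(1)] by blast
    have "a \<bullet> x + b = a' \<bullet> x + b'"
    proof (rule affine_eq_on_convex_hull)
      fix z assume "z \<in> C"
      then show "a \<bullet> z + b = a' \<bullet> z + b'"
        using a[of z] a'[of z] eq[of z] C by (auto simp: hull_inc)
    qed (use K C in auto)
    then show ?thesis using a a' K by simp
  qed (simp add: P1_outside[OF u] P1_outside[OF w])
qed

text \<open>Conformity makes the elementwise interpolants fit together: \<open>K \<inter> K'\<close>
  is a face of both elements, so its extreme points are vertices of both, and by Krein-Milman it is
  their hull. Two affine functions that agree at those points agree on the whole
  intersection.\<close>

lemma P1_interpolation_ex: "\<exists>u\<in>P1 \<Omega> \<T>. \<forall>z\<in>\<N>. u z = g z"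
proof -
  have "\<forall>K\<in>\<T>. \<exists>a b. \<forall>z. z extreme_point_of K \<longrightarrow> a \<bullet> z + b = g z"
    by (metis affine_interpolation element_vertices)
  then obtain a b where ab:
    "\<And>K z. K \<in> \<T> \<Longrightarrow> z extreme_point_of K \<Longrightarrow> a K \<bullet> z + b K = g z" by metis
  have glue: "a K \<bullet> x + b K = a K' \<bullet> x + b K'"
    if K: "K \<in> \<T>" "K' \<in> \<T>" "x \<in> K" "x \<in> K'" for K K' x
  proof (rule affine_eq_on_convex_hull)
    have F: "(K \<inter> K') face_of K" "(K \<inter> K') face_of K'"
      using mesh_Int_face[of K K'] mesh_Int_face[of K' K] K by (auto simp: Int_commute)
    have "z extreme_point_of K \<and> z extreme_point_of K'" if "z extreme_point_of (K \<inter> K')" for z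
      using that extreme_point_of_face[OF F(1), of z] extreme_point_of_face[OF F(2), of z] by simp
    then show "a K \<bullet> z + b K = a K' \<bullet> z + b K'" if "z \<in> {z. z extreme_point_of (K \<inter> K')}" for z
      using that ab K by simp
    show "x \<in> convex hull {z. z extreme_point_of (K \<inter> K')}"
      using Krein_Milman_Minkowski[of "K \<inter> K'"] K
      by (simp add: compact_Int compact_element convex_Int convex_element)
  qed
  \<comment> \<open>An arbitrary element containing \<open>x\<close> is chosen; \<open>glue\<close>
    shows that the choice does not matter.\<close>
  define u where "u x = (if x \<in> closure \<Omega> then
      (let K = SOME K. K \<in> \<T> \<and> x \<in> K in a K \<bullet> x + b K) else 0)" for x
  have u: "u x = a K \<bullet> x + b K" if "K \<in> \<T>" "x \<in> K" for K x
  proof -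
    have "(SOME K. K \<in> \<T> \<and> x \<in> K) \<in> \<T> \<and> x \<in> (SOME K. K \<in> \<T> \<and> x \<in> K)"
      using that by (intro someI) auto
    moreover have "x \<in> closure \<Omega>" using that Union_mesh by auto
    ultimately show ?thesis unfolding u_def Let_def
      using glue[of "SOME K. K \<in> \<T> \<and> x \<in> K" K x] that by presburger
  qed
  have "continuous_on (\<Union>K\<in>\<T>. K) u"
  proof (rule continuous_on_closed_Union[OF finite_mesh])
    fix K assume K: "K \<in> \<T>"
    show "closed K" using compact_element[OF K] compact_imp_closed by blast
    have "continuous_on K (\<lambda>x. a K \<bullet> x + b K)" by (intro continuous_intros)
    then show "continuous_on K u" using u[OF K] by (simp cong: continuous_on_cong)
  qed
  then have "u \<in> P1 \<Omega> \<T>"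
    using Union_mesh u by (auto simp: P1_def u_def[of "_"])
  moreover have "u z = g z" if "z \<in> \<N>" for z
    using that u ab by (auto simp: nodes_def extreme_point_of_def)
  ultimately show ?thesis by blast
qed

text \<open>Modelled on \<open>nodal_basis\<close>, which thereby becomes the interpolant of the
  indicator of a single point.\<close>

definition interpolant :: "(real^3 \<Rightarrow> real) \<Rightarrow> real^3 \<Rightarrow> real" where
  "interpolant g = (THE u. u \<in> P1 \<Omega> \<T> \<and> (\<forall>z\<in>\<N>. u z = g z))"

lemma interpolant:
  shows interpolant_P1: "interpolant g \<in> P1 \<Omega> \<T>"
    and interpolant_node: "z \<in> \<N> \<Longrightarrow> interpolant g z = g z"
proof -
  have "\<exists>!u. u \<in> P1 \<Omega> \<T> \<and> (\<forall>z\<in>\<N>. u z = g z)"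
    using P1_interpolation_ex[of g] P1_eqI by (metis (no_types, lifting))
  from theI'[OF this] show "interpolant g \<in> P1 \<Omega> \<T>" "z \<in> \<N> \<Longrightarrow> interpolant g z = g z"
    by (auto simp: interpolant_def)
qed

section \<open>Hat functions and positivity of the lumping weights\<close>

lemma nodal_basis_interpolant:
  "nodal_basis \<Omega> \<T> z = interpolant (\<lambda>z'. if z' = z then 1 else 0)"
  by (simp add: nodal_basis_def interpolant_def)

lemma nodal_basis_P1: "nodal_basis \<Omega> \<T> z \<in> P1 \<Omega> \<T>"
  by (simp add: nodal_basis_interpolant interpolant_P1)

lemma nodal_basis_node: "z' \<in> \<N> \<Longrightarrow> nodal_basis \<Omega> \<T> z z' = (if z' = z then 1 else 0)"
  by (simp add: nodal_basis_interpolant interpolant_node)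

text \<open>The vertex values are 0 or 1, and the half-space on which an affine function is
  nonnegative is convex, so nonnegativity passes from the vertices to the element.\<close>

lemma nodal_basis_nonneg: "nodal_basis \<Omega> \<T> z x \<ge> 0"
proof (cases "x \<in> closure \<Omega>")
  case True
  then obtain K where K: "K \<in> \<T>" "x \<in> K" using Union_mesh by auto
  obtain C where C: "K = convex hull C" "C \<subseteq> \<N>" using element_vertices[OF K(1)] .
  obtain a b where a: "\<And>x. x \<in> K \<Longrightarrow> nodal_basis \<Omega> \<T> z x = a \<bullet> x + b"
    using P1_affineE[OF nodal_basis_P1 K(1)] by blast
  have "convex hull C \<subseteq> {x. a \<bullet> x \<ge> - b}"
  proof (intro hull_minimal subsetI CollectI convex_halfspace_ge)
    fix y assume y: "y \<in> C"
    then have "nodal_basis \<Omega> \<T> z y \<ge> 0" using C nodal_basis_node by (auto simp: subset_iff)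
    then show "- b \<le> a \<bullet> y" using a[of y] y C by (simp add: hull_inc)
  qed
  then show ?thesis using a[OF K(2)] K(2) C by auto
qed (simp add: P1_outside[OF nodal_basis_P1])

lemma P1_bounded: "u \<in> P1 \<Omega> \<T> \<Longrightarrow> \<exists>B. \<forall>x. \<bar>u x\<bar> \<le> B"
proof -
  assume u: "u \<in> P1 \<Omega> \<T>"
  have "compact (u ` closure \<Omega>)"
    using u bounded_domain by (intro compact_continuous_image) (auto simp: P1_def)
  then obtain B where "\<forall>y\<in>u ` closure \<Omega>. norm y \<le> B"
    using compact_imp_bounded bounded_iff by blast
  then have "\<bar>u x\<bar> \<le> max B 0" for x
    using P1_outside[OF u, of x] by (cases "x \<in> closure \<Omega>") (auto simp: le_max_iff_disj)
  then show ?thesis by blast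
qed

lemma P1_borel [measurable]: 
  assumes "u \<in> P1 \<Omega> \<T>" shows "u \<in> borel_measurable borel"
proof -
  have "(\<lambda>x. indicator (closure \<Omega>) x *\<^sub>R u x) \<in> borel_measurable borel"
    using assms by (intro borel_measurable_continuous_on_indicator) (auto simp: P1_def)
  moreover have "(\<lambda>x. indicator (closure \<Omega>) x *\<^sub>R u x) = u"
    using P1_outside[OF assms] by (auto simp: fun_eq_iff indicator_def)
  ultimately show ?thesis by simp
qed

lemma domain_sets: "\<Omega> \<in> sets lebesgue" and emeasure_domain: "emeasure lebesgue \<Omega> < \<infinity>"
  using lmeasurable_open[OF bounded_domain open_domain] by (auto simp: fmeasurable_def)

text \<open>By continuity the hat function exceeds 1/2 on the closed domain near \<open>z\<close>.
  The node may lie on the boundary, but the open domain meets every ball around a point of its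
  closure, and this open intersection has positive measure.\<close>

lemma node_weight_pos:
  assumes z: "z \<in> \<N>" shows "node_weight \<Omega> \<T> z > 0"
proof -
  let ?\<phi> = "nodal_basis \<Omega> \<T> z"
  have cont: "continuous_on (closure \<Omega>) ?\<phi>" using nodal_basis_P1 by (simp add: P1_def)
  have z1: "?\<phi> z = 1" "z \<in> closure \<Omega>" using nodal_basis_node[OF z, of z] z nodes_subset by auto
  obtain d where d: "d > 0" "\<And>x. x \<in> closure \<Omega> \<Longrightarrow> dist x z < d \<Longrightarrow> dist (?\<phi> x) (?\<phi> z) < 1/2"
    using cont z1(2) unfolding continuous_on_iff by (meson half_gt_zero zero_less_one)
  define U where "U = \<Omega> \<inter> ball z d"
  have U: "open U" "U \<noteq> {}"
    using open_domain z1(2) d(1) open_Int_closure_eq_empty[of "ball z d" \<Omega>]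
    by (auto simp: U_def Int_commute)
  have Um: "U \<in> lmeasurable"
    using U bounded_domain by (intro lmeasurable_open) (auto simp: U_def intro: bounded_subset)
  have int: "set_integrable lebesgue \<Omega> ?\<phi>"
  proof -
    obtain B where B: "\<And>x. \<bar>?\<phi> x\<bar> \<le> B" using P1_bounded[OF nodal_basis_P1] by blast
    show ?thesis unfolding set_integrable_def
      by (rule integrableI_bounded_set_indicator[where B=B])
        (use B domain_sets emeasure_domain P1_borel[OF nodal_basis_P1] in
          \<open>auto intro: measurable_completion\<close>)
  qed
  have "0 < measure lebesgue U / 2"
    using U Um open_not_negligible[OF U] 
    by (metis divide_pos_pos measure_nonneg negligible_iff_measure order_less_le zero_less_numeral)
  also have "\<dots> = (LINT x|lebesgue. indicator U x *\<^sub>R (1/2 :: real))"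
    using Um by simp
  also have "\<dots> \<le> (LINT x:\<Omega>|lebesgue. ?\<phi> x)"
    unfolding set_lebesgue_integral_def
  proof (rule integral_mono)
    show "integrable lebesgue (\<lambda>x. indicator U x *\<^sub>R (1/2 :: real))" using Um by (auto simp: fmeasurable_def)
    show "integrable lebesgue (\<lambda>x. indicat_real \<Omega> x *\<^sub>R ?\<phi> x)" using int by (simp add: set_integrable_def)
    fix x
    show "indicator U x *\<^sub>R (1/2 :: real) \<le> indicat_real \<Omega> x *\<^sub>R ?\<phi> x"
    proof (cases "x \<in> U")
      case True
      then have "dist (?\<phi> x) 1 < 1/2"
        using d(2)[of x] z1(1) closure_subset[of \<Omega>] by (auto simp: U_def dist_commute)
      then show ?thesis using True by (simp add: U_def dist_real_def indicator_def abs_if split: if_splits)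
    qed (use nodal_basis_nonneg in \<open>auto simp: indicator_def\<close>)
  qed
  finally show ?thesis by (simp add: node_weight_def)
qed

end

section \<open>Uniqueness of weak gradients\<close>

text \<open>On the compact closure of \<open>S\<close> the continuous factor is bounded, so the
  product is dominated by a multiple of \<open>norm (f x)\<close>. A general bilinear
  \<open>h\<close> covers both orders of scalar and vector factor, and the extraction of a
  component, in the weak formulation.\<close>

lemma bounded_bilinear_set_integrable:
  fixes f :: "'n::euclidean_space \<Rightarrow> 'a::euclidean_space"
    and g :: "'n \<Rightarrow> 'b::euclidean_space" and h :: "'a \<Rightarrow> 'b \<Rightarrow> 'c::euclidean_space"
  assumes h: "bounded_bilinear h" and S: "open S" "bounded S"
    and f: "set_integrable lebesgue S f" and g: "continuous_on UNIV g"
  shows "set_integrable lebesgue S (\<lambda>x. h (f x) (g x))"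
proof -
  interpret h: bounded_bilinear h by fact
  obtain C where C: "C > 0" "\<And>a b. norm (h a b) \<le> norm a * norm b * C"
    using h.pos_bounded by blast
  have "compact (g ` closure S)"
    using S g by (intro compact_continuous_image) (auto intro: continuous_on_subset)
  then obtain B where B: "\<And>x. x \<in> closure S \<Longrightarrow> norm (g x) \<le> B"
    using compact_imp_bounded bounded_iff by (metis imageI)
  have "(\<lambda>x. indicator S x *\<^sub>R f x) \<in> borel_measurable lebesgue"
    using f by (auto simp: set_integrable_def)
  moreover have "g \<in> borel_measurable lebesgue"
    using g by (intro measurable_completion) (auto intro: borel_measurable_continuous_onI)
  moreover have "continuous_on UNIV (\<lambda>p. h (fst p) (snd p))"
    by (intro h.continuous_on continuous_intros)
  ultimately have "(\<lambda>x. h (indicator S x *\<^sub>R f x) (g x)) \<in> borel_measurable lebesgue"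
    by (rule borel_measurable_continuous_Pair[where H=h])
  then have meas: "(\<lambda>x. indicator S x *\<^sub>R h (f x) (g x)) \<in> borel_measurable lebesgue"
    by (simp add: h.scaleR_left)
  show ?thesis unfolding set_integrable_def
  proof (rule Bochner_Integration.integrable_bound[OF _ meas])
    show "integrable lebesgue (\<lambda>x. (B * C) *\<^sub>R norm (indicator S x *\<^sub>R f x))"
      using f by (intro integrable_scaleR_right integrable_norm) (simp add: set_integrable_def)
    show "AE x in lebesgue. norm (indicator S x *\<^sub>R h (f x) (g x))
        \<le> norm ((B * C) *\<^sub>R norm (indicator S x *\<^sub>R f x))"
    proof (intro AE_I2)
      fix x
      have "norm (h (f x) (g x)) \<le> norm (f x) * B * C" if "x \<in> S"
      proof -
        have "norm (g x) \<le> B" using B[of x] that closure_subset[of S] by blast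
        then have "norm (f x) * norm (g x) * C \<le> norm (f x) * B * C"
          using C(1) by (intro mult_right_mono mult_left_mono) auto
        then show ?thesis using C(2)[of "f x" "g x"] by linarith
      qed
      then show "norm (indicator S x *\<^sub>R h (f x) (g x))
        \<le> norm ((B * C) *\<^sub>R norm (indicator S x *\<^sub>R f x))"
        by (cases "x \<in> S") (auto simp: mult_ac intro: order.trans[OF _ abs_ge_self])
    qed
  qed
qed

section \<open>C^1 test functions that approximate indicators of boxes\<close>

lemma square_pos_part_deriv:
  "((\<lambda>t::real. (max 0 t)\<^sup>2) has_real_derivative 2 * max 0 t) (at t)"
proof -
  consider "t > 0" | "t < 0" | "t = 0" by linarith
  then show ?thesis
  proof cases
    case 1
    have "((\<lambda>t. t\<^sup>2) has_real_derivative 2 * max 0 t) (at t)"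
      using 1 by (auto intro!: derivative_eq_intros)
    then show ?thesis
      by (rule has_field_derivative_transform_within_open[where S="{0<..}"]) (use 1 in auto)
  next
    case 2
    have "((\<lambda>t. 0) has_real_derivative 2 * max 0 t) (at t)"
      using 2 by simp
    then show ?thesis
      by (rule has_field_derivative_transform_within_open[where S="{..<0}"]) (use 2 in auto)
  next
    case 3
    \<comment> \<open>At the kink the difference quotient is bounded by
      \<open>\<bar>h\<bar>\<close>; squaring the positive part is what makes it differentiable
      there.\<close>
    have "(\<lambda>h::real. (max 0 h)\<^sup>2 / h) \<midarrow>0\<rightarrow> 0"
    proof (rule Lim_null_comparison[where g=abs])
      show "\<forall>\<^sub>F x::real in at 0. norm ((max 0 x)\<^sup>2 / x) \<le> \<bar>x\<bar>"
        by (intro always_eventually allI) (auto simp: max_def power2_eq_square)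
      show "abs \<midarrow>0\<rightarrow> (0::real)" by (rule tendsto_rabs_zero) simp
    qed
    then show ?thesis using 3 by (simp add: DERIV_def)
  qed
qed

text \<open>The gradient is hidden behind a quantifier so that finite products can be handled by
  induction without an explicit formula for their gradient.\<close>

definition C1_function :: "('a::real_inner \<Rightarrow> real) \<Rightarrow> bool" where
  "C1_function p \<longleftrightarrow> (\<exists>Dp. (\<forall>x. GDERIV p x :> Dp x) \<and> continuous_on UNIV Dp)"

lemma GDERIV_imp_continuous_on: "(\<And>x. GDERIV p x :> Dp x) \<Longrightarrow> continuous_on S p"
  by (intro continuous_at_imp_continuous_on) (auto simp: gderiv_def intro: has_derivative_continuous)

lemma C1_function_mult:
  assumes "C1_function p" "C1_function q" shows "C1_function (\<lambda>x. p x * q x)"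
proof -
  obtain Dp Dq where p: "\<And>x. GDERIV p x :> Dp x" "continuous_on UNIV Dp"
    and q: "\<And>x. GDERIV q x :> Dq x" "continuous_on UNIV Dq"
    using assms unfolding C1_function_def by blast
  have "\<forall>x. GDERIV (\<lambda>x. p x * q x) x :> (p x *\<^sub>R Dq x + q x *\<^sub>R Dp x)"
    using GDERIV_mult p q by blast
  moreover have "continuous_on UNIV (\<lambda>x. p x *\<^sub>R Dq x + q x *\<^sub>R Dp x)"
    using p q GDERIV_imp_continuous_on[OF p(1)] GDERIV_imp_continuous_on[OF q(1)]
    by (intro continuous_intros)
  ultimately show ?thesis unfolding C1_function_def
    by (intro exI[of _ "\<lambda>x. p x *\<^sub>R Dq x + q x *\<^sub>R Dp x"]) blast
qed

lemma C1_function_prod: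
  "finite I \<Longrightarrow> (\<And>i. i \<in> I \<Longrightarrow> C1_function (p i)) \<Longrightarrow> C1_function (\<lambda>x. \<Prod>i\<in>I. p i x)"
proof (induction I rule: finite_induct)
  case empty
  show ?case unfolding C1_function_def by (auto intro!: exI[of _ "\<lambda>_. 0"] GDERIV_const)
qed (simp add: C1_function_mult)

text \<open>Such a function is positive exactly where \<open>e \<bullet> x + c > 0\<close>. An open
  box is a finite intersection of sets of this form, so a product of these functions is positive
  exactly on the box.\<close>

lemma C1_function_halfspace: "C1_function (\<lambda>x::'a::real_inner. (max 0 (e \<bullet> x + c))\<^sup>2)"
proof -
  have g: "GDERIV (\<lambda>x. e \<bullet> x + c) x :> e" for x
    unfolding gderiv_def by (auto intro!: derivative_eq_intros simp: inner_commute)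
  have "GDERIV (\<lambda>x. (max 0 (e \<bullet> x + c))\<^sup>2) x :> (2 * max 0 (e \<bullet> x + c)) *\<^sub>R e" for x
    using GDERIV_DERIV_compose[OF g square_pos_part_deriv] .
  moreover have "continuous_on UNIV (\<lambda>x. (2 * max 0 (e \<bullet> x + c)) *\<^sub>R e)"
    by (intro continuous_intros)
  ultimately show ?thesis unfolding C1_function_def
    by (intro exI[of _ "\<lambda>x. (2 * max 0 (e \<bullet> x + c)) *\<^sub>R e"]) blast
qed

lemma C1_bump_box:
  fixes a b :: "'a::euclidean_space"
  obtains p where "C1_function p" "\<And>x. p x \<ge> 0" "\<And>x. p x \<noteq> 0 \<longleftrightarrow> x \<in> box a b"
proof
  let ?p = "\<lambda>x. \<Prod>i\<in>Basis. (max 0 (i \<bullet> x + - (a \<bullet> i)))\<^sup>2 * (max 0 (- i \<bullet> x + b \<bullet> i))\<^sup>2"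
  show "C1_function ?p"
    by (intro C1_function_prod C1_function_mult C1_function_halfspace finite_Basis)
  show "?p x \<ge> 0" for x by (intro prod_nonneg) auto
  show "?p x \<noteq> 0 \<longleftrightarrow> x \<in> box a b" for x
  proof -
    have "(max 0 t)\<^sup>2 = 0 \<longleftrightarrow> t \<le> 0" for t :: real by (simp add: max_def)
    then show ?thesis by (simp add: prod_zero_iff mem_box not_le inner_commute[of x])
  qed
qed

text \<open>As \<open>c \<rightarrow> \<infinity>\<close> these test functions increase to the indicator function of the box.\<close>

lemma test_function_exp:
  assumes p: "\<And>x. GDERIV p x :> Dp x" "continuous_on UNIV Dp"
    and box: "\<And>x. p x \<noteq> 0 \<longleftrightarrow> x \<in> box a b" and sub: "cbox a b \<subseteq> \<Omega>"
  shows "test_function \<Omega> (\<lambda>x. 1 - exp (- (c * p x))) (\<lambda>x. (c * exp (- (c * p x))) *\<^sub>R Dp x)"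
proof -
  have "GDERIV (\<lambda>x. 1 - exp (- (c * p x))) x :> (c * exp (- (c * p x))) *\<^sub>R Dp x" for x
    by (rule GDERIV_DERIV_compose[OF p(1)]) (auto intro!: derivative_eq_intros)
  moreover have "continuous_on UNIV (\<lambda>x. (c * exp (- (c * p x))) *\<^sub>R Dp x)"
    using p GDERIV_imp_continuous_on[OF p(1)] by (intro continuous_intros)
  moreover have supp: "closure {x. 1 - exp (- (c * p x)) \<noteq> 0} \<subseteq> cbox a b"
    using box box_subset_cbox by (intro closure_minimal) auto
  moreover have "compact (closure {x. 1 - exp (- (c * p x)) \<noteq> 0})"
    using supp bounded_cbox bounded_subset closed_closure compact_eq_bounded_closed by blast
  ultimately show ?thesis using sub by (auto simp: test_function_def)
qed

text \<open>Dominated convergence with majorant \<open>norm (f x)\<close> on \<open>S\<close>: the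
  test functions take values in [0,1], and every integral in the sequence is 0.\<close>

lemma integral_box_eq_0:
  fixes f :: "real^3 \<Rightarrow> 'b::euclidean_space"
  assumes S: "open S" "bounded S" and f: "set_integrable lebesgue S f"
    and zero: "\<And>\<psi> D\<psi>. test_function S \<psi> D\<psi> \<Longrightarrow> (LINT x:S|lebesgue. \<psi> x *\<^sub>R f x) = 0"
    and sub: "cbox a b \<subseteq> S"
  shows "(LINT x:box a b|lebesgue. f x) = 0"
proof -
  obtain p where p: "C1_function p" "\<And>x. p x \<ge> 0" "\<And>x. p x \<noteq> 0 \<longleftrightarrow> x \<in> box a b"
    by (rule C1_bump_box[of a b], rule that)
  obtain Dp where Dp: "\<And>x. GDERIV p x :> Dp x" "continuous_on UNIV Dp"
    using p(1) by (auto simp: C1_function_def)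
  define \<psi> where "\<psi> n x = 1 - exp (- (real n * p x))" for n x
  have \<psi>: "test_function S (\<psi> n) (\<lambda>x. (real n * exp (- (real n * p x))) *\<^sub>R Dp x)" for n
    unfolding \<psi>_def by (rule test_function_exp[OF Dp p(3) sub])
  have "(\<lambda>n. LINT x:S|lebesgue. \<psi> n x *\<^sub>R f x) \<longlonglongrightarrow> (LINT x:box a b|lebesgue. f x)"
    unfolding set_lebesgue_integral_def
  proof (rule integral_dominated_convergence[where w="\<lambda>x. norm (indicator S x *\<^sub>R f x)"])
    have meas: "(\<lambda>x. indicator S x *\<^sub>R f x) \<in> borel_measurable lebesgue"
      using f by (auto simp: set_integrable_def)
    show "integrable lebesgue (\<lambda>x. norm (indicat_real S x *\<^sub>R f x))"
      using f by (intro integrable_norm) (simp add: set_integrable_def)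
    have *: "continuous_on UNIV (\<psi> n)" for n
      using \<psi>[of n] by (auto simp: test_function_def intro: GDERIV_imp_continuous_on)
    have "set_integrable lebesgue S (\<lambda>x. \<psi> n x *\<^sub>R f x)" for n
      by (rule bounded_bilinear_set_integrable[OF bounded_bilinear.flip[OF bounded_bilinear_scaleR] S f *])
    then show "(\<lambda>x. indicat_real S x *\<^sub>R \<psi> n x *\<^sub>R f x) \<in> borel_measurable lebesgue" for n
      by (auto simp: set_integrable_def)
    have "(\<lambda>x. indicator (box a b) x *\<^sub>R (indicator S x *\<^sub>R f x)) \<in> borel_measurable lebesgue"
      by (intro borel_measurable_scaleR[OF _ meas] borel_measurable_indicator) simp
    moreover have "indicator (box a b) x *\<^sub>R (indicator S x *\<^sub>R f x) = indicat_real (box a b) x *\<^sub>R f x" for x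
      using sub box_subset_cbox[of a b] by (auto simp: indicator_def)
    ultimately show "(\<lambda>x. indicat_real (box a b) x *\<^sub>R f x) \<in> borel_measurable lebesgue"
      by (simp only:)
    show "AE x in lebesgue. (\<lambda>n. indicat_real S x *\<^sub>R \<psi> n x *\<^sub>R f x)
        \<longlonglongrightarrow> indicat_real (box a b) x *\<^sub>R f x"
    proof (intro AE_I2)
      fix x
      show "(\<lambda>n. indicat_real S x *\<^sub>R \<psi> n x *\<^sub>R f x) \<longlonglongrightarrow> indicat_real (box a b) x *\<^sub>R f x"
      proof (cases "x \<in> box a b")
        case True
        then have px: "p x > 0" and xS: "x \<in> S"
          using p(2)[of x] p(3)[of x] sub box_subset_cbox[of a b] by auto
        \<comment> \<open>For fixed \<open>x\<close> in the box the exponential is a geometric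
          sequence with ratio below 1.\<close>
        have "(\<lambda>n. exp (- p x) ^ n) \<longlonglongrightarrow> 0"
          using px by (intro LIMSEQ_power_zero) simp
        then have "(\<lambda>n. 1 - exp (- (real n * p x))) \<longlonglongrightarrow> 1 - 0"
          by (intro tendsto_diff tendsto_const) (simp add: exp_of_nat_mult[symmetric])
        then have "(\<lambda>n. \<psi> n x *\<^sub>R f x) \<longlonglongrightarrow> (1 - 0) *\<^sub>R f x"
          unfolding \<psi>_def by (intro tendsto_scaleR tendsto_const)
        then show ?thesis using True xS by simp
      next
        case False
        then show ?thesis using p(3)[of x] by (simp add: \<psi>_def)
      qed
    qed
    show "AE x in lebesgue. norm (indicat_real S x *\<^sub>R \<psi> n x *\<^sub>R f x)
        \<le> norm (indicat_real S x *\<^sub>R f x)" for n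
    proof (intro AE_I2)
      fix x
      have "\<bar>\<psi> n x\<bar> \<le> 1" using p(2)[of x] by (simp add: \<psi>_def)
      then show "norm (indicat_real S x *\<^sub>R \<psi> n x *\<^sub>R f x) \<le> norm (indicat_real S x *\<^sub>R f x)"
        by (simp add: mult_left_le_one_le indicator_def)
    qed
  qed
  then show ?thesis using zero[OF \<psi>] by (simp add: LIMSEQ_const_iff)
qed

section \<open>From vanishing integrals over boxes to vanishing almost everywhere\<close>

lemma sigma_finite_lebesgue: "sigma_finite_measure (lebesgue :: 'a::euclidean_space measure)"
proof
  obtain A :: "'a set set" where A: "countable A" "A \<subseteq> sets lborel" "\<Union>A = space lborel"
    "\<forall>a\<in>A. emeasure lborel a \<noteq> \<infinity>"
    using lborel.sigma_finite_countable by blast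
  then show "\<exists>A. countable A \<and> A \<subseteq> sets lebesgue \<and> \<Union>A = space (lebesgue :: 'a measure) \<and>
      (\<forall>a\<in>A. emeasure lebesgue a \<noteq> \<infinity>)"
    by (intro exI[of _ A]) (auto simp: subset_iff)
qed

text \<open>The sets over which \<open>g\<close> has integral 0 form a Dynkin system containing the
  intersection-stable generator of open boxes, hence all Borel sets. A density that integrates to 0
  over every measurable set vanishes almost everywhere.\<close>

lemma AE_eq_0_if_integral_boxes_eq_0:
  fixes g :: "'a::euclidean_space \<Rightarrow> 'b::euclidean_space"
  assumes g: "integrable lebesgue g" and univ: "integral\<^sup>L lebesgue g = 0"
    and box: "\<And>a b. (LINT x:box a b|lebesgue. g x) = 0"
  shows "AE x in lebesgue. g x = 0"
proof -
  have int: "set_integrable lebesgue A g" if "A \<in> sets lebesgue" for A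
    using integrable_mult_indicator[OF that g] by (simp add: set_integrable_def)
  have borel: "(LINT x:A|lebesgue. g x) = 0" if "A \<in> sets borel" for A
  proof -
    have sets: "sigma_sets UNIV (range (\<lambda>(a, b). box a b :: 'a set)) = sets borel"
      unfolding borel_eq_box by simp
    have "Int_stable (range (\<lambda>(a, b). box a b :: 'a set))"
      by (auto simp: Int_stable_def box_Int_box)
    moreover have "range (\<lambda>(a, b). box a b :: 'a set) \<subseteq> Pow UNIV" by simp
    moreover have "A \<in> sigma_sets UNIV (range (\<lambda>(a, b). box a b :: 'a set))"
      using that sets by simp
    ultimately show ?thesis
    proof (induction A rule: sigma_sets_induct_disjoint)
      case (basic A)
      then show ?case using box by auto
    next
      case (compl A)
      then have A: "A \<in> sets lebesgue"
        by (simp add: sets sets_completionI_sets)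
      \<comment> \<open>Complements use the hypothesis \<open>univ\<close>: the whole space is not a
        box.\<close>
      have "(LINT x:A \<union> (UNIV - A)|lebesgue. g x) = (LINT x:A|lebesgue. g x) + (LINT x:UNIV - A|lebesgue. g x)"
        using A by (intro set_integral_Un int) auto
      moreover have "A \<union> (UNIV - A) = UNIV" by auto
      ultimately show ?case using compl.IH univ by (simp add: set_lebesgue_integral_def)
    next
      case (union A)
      then have A: "A i \<in> sets lebesgue" for i
        by (auto simp: sets intro!: sets_completionI_sets)
      have "(LINT x:(\<Union>i. A i)|lebesgue. g x) = (\<Sum>i. (LINT x:(A i)|lebesgue. g x))"
        using union A by (intro lebesgue_integral_countable_add int sets.countable_nat_UN)
          (auto simp: disjoint_family_on_def)
      then show ?case using union.IH by simp
    next
      case empty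
      then show ?case by (simp add: set_lebesgue_integral_def)
    qed
  qed
  show ?thesis
  proof (rule sigma_finite_measure.density_unique_banach[OF sigma_finite_lebesgue g])
    show "integrable lebesgue (\<lambda>_::'a. 0 :: 'b)" by simp
    fix A :: "'a set" assume "A \<in> sets lebesgue"
    \<comment> \<open>A Lebesgue set is a Borel set up to a subset of a null set, which does not
      change the integral.\<close>
    then obtain B N N' where B: "A = B \<union> N" "N \<subseteq> N'" "N' \<in> null_sets lborel" "B \<in> sets lborel"
      by (auto elim: sets_completionE)
    have "AE x in lebesgue. x \<notin> N'"
      using B(3) by (intro AE_not_in null_sets_completionI)
    then have "(LINT x:A|lebesgue. g x) = (LINT x:B|lebesgue. g x)"
      unfolding set_lebesgue_integral_def
    proof (intro integral_cong_AE)
      show "(\<lambda>x. indicat_real A x *\<^sub>R g x) \<in> borel_measurable lebesgue"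
        using int[OF \<open>A \<in> sets lebesgue\<close>] by (auto simp: set_integrable_def)
      show "(\<lambda>x. indicat_real B x *\<^sub>R g x) \<in> borel_measurable lebesgue"
        using int[of B] B by (auto simp: set_integrable_def)
      show "AE x in lebesgue. indicat_real A x *\<^sub>R g x = indicat_real B x *\<^sub>R g x"
        if "AE x in lebesgue. x \<notin> N'"
        using that by eventually_elim (use B in \<open>auto simp: indicator_def\<close>)
    qed
    then show "(LINT x:A|lebesgue. g x) = (LINT x:A|lebesgue. 0)"
      using borel[of B] B by simp
  qed
qed

text \<open>Localisation: for a closed box inside \<open>S\<close>, cutting \<open>f\<close> off to
  its interior gives a function integrable on the whole space. Its integral over any other box is an
  integral of \<open>f\<close> over an intersection of two boxes, again a box. Countably many closed
  boxes exhaust \<open>S\<close>.\<close>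

lemma du_Bois_Reymond:
  fixes f :: "real^3 \<Rightarrow> 'b::euclidean_space"
  assumes S: "open S" "bounded S" and f: "set_integrable lebesgue S f"
    and zero: "\<And>\<psi> D\<psi>. test_function S \<psi> D\<psi> \<Longrightarrow> (LINT x:S|lebesgue. \<psi> x *\<^sub>R f x) = 0"
  shows "AE x in lebesgue. x \<in> S \<longrightarrow> f x = 0"
proof -
  have boxes: "AE x in lebesgue. x \<in> cbox a b \<longrightarrow> f x = 0" if sub: "cbox a b \<subseteq> S" for a b
  proof -
    let ?g = "\<lambda>x. indicat_real (box a b) x *\<^sub>R f x"
    have "set_integrable lebesgue (box a b) f"
      using sub box_subset_cbox[of a b] by (intro set_integrable_subset[OF f]) auto
    then have "integrable lebesgue ?g" by (simp add: set_integrable_def)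
    moreover have "integral\<^sup>L lebesgue ?g = 0"
      using integral_box_eq_0[OF S f zero sub] by (simp add: set_lebesgue_integral_def)
    moreover have "(LINT x:box c d|lebesgue. ?g x) = 0" for c d
    proof -
      obtain u v where uv: "box a b \<inter> box c d = box u v"
        using box_Int_box[of a b c d] by blast
      \<comment> \<open>\<open>integral_box_eq_0\<close> asks for the closed box to lie in
        \<open>S\<close>. A nonempty open box has the closed box as its closure, which stays inside
        \<open>cbox a b\<close>; the empty case needs its own treatment.\<close>
      then have "box u v = {} \<or> cbox u v \<subseteq> cbox a b"
        using closure_box[of u v] closure_mono[of "box u v" "cbox a b"] box_subset_cbox[of a b]
        by (cases "box u v = {}") auto
      then have "(LINT x:box u v|lebesgue. f x) = 0"
        using integral_box_eq_0[OF S f zero, where a=u and b=v] sub by (auto simp: set_lebesgue_integral_def)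
      moreover have "indicat_real (box c d) x *\<^sub>R ?g x = indicat_real (box u v) x *\<^sub>R f x" for x
        unfolding uv[symmetric] by (auto simp: indicator_def)
      ultimately show ?thesis by (simp only: set_lebesgue_integral_def)
    qed
    ultimately have "AE x in lebesgue. ?g x = 0" by (rule AE_eq_0_if_integral_boxes_eq_0)
    moreover have "AE x in lebesgue. x \<notin> cbox a b - box a b"
      using negligible_frontier_interval[of a b] by (intro AE_not_in) (simp add: negligible_iff_null_sets)
    ultimately show ?thesis by eventually_elim auto
  qed
  obtain \<D> where D: "countable \<D>" "\<And>X. X \<in> \<D> \<Longrightarrow> X \<subseteq> S \<and> (\<exists>a b. X = cbox a b)" "\<Union>\<D> = S"
    using open_countable_Union_open_cbox[OF S(1)] by (metis Pow_iff subsetD)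
  have "AE x in lebesgue. \<forall>X\<in>\<D>. x \<in> X \<longrightarrow> f x = 0"
    using D boxes by (subst AE_ball_countable) blast+
  then show ?thesis by eventually_elim (use D(3) in blast)
qed

section \<open>Square-integrable vector and matrix fields\<close>

lemma borel_measurable_vec:
  fixes f :: "'a \<Rightarrow> 'b::euclidean_space^'n"
  assumes "\<And>i. (\<lambda>x. f x $ i) \<in> borel_measurable M"
  shows "f \<in> borel_measurable M"
proof (subst borel_measurable_euclidean_space, intro ballI)
  fix b :: "'b^'n" assume "b \<in> Basis"
  then obtain i e where "b = axis i e" by (auto simp: Basis_vec_def)
  then show "(\<lambda>x. f x \<bullet> b) \<in> borel_measurable M"
    using assms by (auto simp: inner_axis intro!: borel_measurable_inner)
qed

text \<open>A bounded set has finite measure, so t \<le> 1 + t^2 provides an integrable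
  majorant.\<close>

lemma square_integrable_imp_set_integrable:
  assumes S: "open S" "bounded S" and f: "square_integrable S f"
  shows "set_integrable lebesgue S f"
  unfolding set_integrable_def
proof (rule Bochner_Integration.integrable_bound)
  have "S \<in> lmeasurable" using S by (rule lmeasurable_open[rotated])
  then have "integrable lebesgue (\<lambda>x. indicat_real S x + indicat_real S x *\<^sub>R (norm (f x))\<^sup>2)"
    using f by (intro Bochner_Integration.integrable_add)
      (auto simp: square_integrable_def set_integrable_def fmeasurable_def)
  then show "integrable lebesgue (\<lambda>x. indicat_real S x * (1 + (norm (f x))\<^sup>2))"
    by (simp add: algebra_simps)
  show "(\<lambda>x. indicat_real S x *\<^sub>R f x) \<in> borel_measurable lebesgue"
    using f by (simp add: square_integrable_def set_borel_measurable_def)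
  have "t \<le> 1 + t\<^sup>2" for t :: real
    using sum_squares_bound[of t 1] zero_le_power2[of t] by (smt (verit) power_one)
  then show "AE x in lebesgue. norm (indicat_real S x *\<^sub>R f x)
      \<le> norm (indicat_real S x * (1 + (norm (f x))\<^sup>2))"
    by (intro AE_I2) (auto simp: indicator_def)
qed

lemma square_integrable_inner:
  assumes f: "square_integrable S f" and g: "square_integrable S g"
  shows "set_integrable lebesgue S (\<lambda>x. f x \<bullet> g x)"
  unfolding set_integrable_def
proof (rule Bochner_Integration.integrable_bound)
  show "integrable lebesgue (\<lambda>x. indicat_real S x *\<^sub>R (norm (f x))\<^sup>2 + indicat_real S x *\<^sub>R (norm (g x))\<^sup>2)"
    using f g by (intro Bochner_Integration.integrable_add)
      (auto simp: square_integrable_def set_integrable_def)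
  have "(\<lambda>x. (indicat_real S x *\<^sub>R f x) \<bullet> (indicat_real S x *\<^sub>R g x)) \<in> borel_measurable lebesgue"
    using f g by (intro borel_measurable_inner) (auto simp: square_integrable_def set_borel_measurable_def)
  moreover have "(indicat_real S x *\<^sub>R f x) \<bullet> (indicat_real S x *\<^sub>R g x) = indicat_real S x *\<^sub>R (f x \<bullet> g x)" for x
    by (simp add: indicator_def)
  ultimately show "(\<lambda>x. indicat_real S x *\<^sub>R (f x \<bullet> g x)) \<in> borel_measurable lebesgue" by (simp only:)
  have "\<bar>a \<bullet> b\<bar> \<le> (norm a)\<^sup>2 + (norm b)\<^sup>2" for a b :: 'a
  proof -
    have "\<bar>a \<bullet> b\<bar> \<le> norm a * norm b" by (rule Cauchy_Schwarz_ineq2)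
    also have "\<dots> \<le> (norm a)\<^sup>2 + (norm b)\<^sup>2"
      using sum_squares_bound[of "norm a" "norm b"] mult_nonneg_nonneg[OF norm_ge_zero norm_ge_zero, of a b]
      by linarith
    finally show ?thesis .
  qed
  then show "AE x in lebesgue. norm (indicat_real S x *\<^sub>R (f x \<bullet> g x))
      \<le> norm (indicat_real S x *\<^sub>R (norm (f x))\<^sup>2 + indicat_real S x *\<^sub>R (norm (g x))\<^sup>2)"
    by (intro AE_I2) (auto simp: indicator_def)
qed

lemma square_integrable_add:
  assumes f: "square_integrable S f" and g: "square_integrable S g"
  shows "square_integrable S (\<lambda>x. f x + g x)"
proof -
  have "set_integrable lebesgue S (\<lambda>x. (norm (f x))\<^sup>2 + ((norm (g x))\<^sup>2 + 2 * (f x \<bullet> g x)))"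
    using f g square_integrable_inner[OF f g] unfolding square_integrable_def
    by (intro set_integral_add set_integrable_mult_right) blast+
  moreover have "(norm (f x + g x))\<^sup>2 = (norm (f x))\<^sup>2 + ((norm (g x))\<^sup>2 + 2 * (f x \<bullet> g x))" for x
    by (simp add: power2_norm_eq_inner inner_add inner_commute)
  moreover have "set_borel_measurable lebesgue S (\<lambda>x. f x + g x)"
    using f g unfolding square_integrable_def set_borel_measurable_def scaleR_add_right
    by (intro borel_measurable_add) blast+
  ultimately show ?thesis by (simp add: square_integrable_def)
qed

lemma square_integrable_scaleR:
  assumes f: "square_integrable S f" shows "square_integrable S (\<lambda>x. c *\<^sub>R f x)"
proof -
  have "set_integrable lebesgue S (\<lambda>x. c\<^sup>2 * (norm (f x))\<^sup>2)"
    using f unfolding square_integrable_def by (intro set_integrable_mult_right) blast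
  moreover have "(\<lambda>x. c *\<^sub>R (indicat_real S x *\<^sub>R f x)) \<in> borel_measurable lebesgue"
    using f unfolding square_integrable_def set_borel_measurable_def
    by (intro borel_measurable_scaleR[OF borel_measurable_const]) blast
  ultimately show ?thesis
    by (simp add: square_integrable_def set_borel_measurable_def power_mult_distrib mult.commute)
qed

lemma square_integrable_bounded:
  assumes S: "open S" "bounded S" and f: "f \<in> borel_measurable borel" and B: "\<And>x. norm (f x) \<le> B"
  shows "square_integrable S f"
proof -
  have "S \<in> lmeasurable" using S by (rule lmeasurable_open[rotated])
  then have Sm: "S \<in> sets lebesgue" "emeasure lebesgue S < \<infinity>" by (auto simp: fmeasurable_def)
  have fm: "f \<in> borel_measurable lebesgue" using f by (intro measurable_completion) simp
  have "set_integrable lebesgue S (\<lambda>x. (norm (f x))\<^sup>2)"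
    unfolding set_integrable_def
  proof (rule integrableI_bounded_set_indicator[where B="B\<^sup>2"])
    show "AE x in lebesgue. x \<in> S \<longrightarrow> norm ((norm (f x))\<^sup>2) \<le> B\<^sup>2"
      using B by (auto intro!: AE_I2 power_mono)
  qed (use Sm fm in auto)
  moreover have "set_borel_measurable lebesgue S f"
    unfolding set_borel_measurable_def using Sm fm by (intro borel_measurable_scaleR) auto
  ultimately show ?thesis by (simp add: square_integrable_def)
qed

section \<open>Linearity and uniqueness of weak gradients\<close>

lemma test_function_continuous:
  assumes "test_function S \<psi> D\<psi>"
  shows "continuous_on UNIV \<psi>" "continuous_on UNIV D\<psi>"
  using assms by (auto simp: test_function_def intro: GDERIV_imp_continuous_on)

text \<open>Needed to split integrals of sums and differences: a non-integrable function has
  integral 0 by convention, so additivity requires integrability of both parts.\<close>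

lemma weak_gradient_integrable:
  assumes S: "open S" "bounded S" and w: "has_weak_gradient S w G" and \<psi>: "test_function S \<psi> D\<psi>"
  shows "set_integrable lebesgue S (\<lambda>x. (w x $ i) *\<^sub>R D\<psi> x)"
    and "set_integrable lebesgue S (\<lambda>x. \<psi> x *\<^sub>R (G x $ i))"
proof -
  have "set_integrable lebesgue S w" "set_integrable lebesgue S G"
    using w square_integrable_imp_set_integrable[OF S] by (auto simp: has_weak_gradient_def)
  then show "set_integrable lebesgue S (\<lambda>x. (w x $ i) *\<^sub>R D\<psi> x)"
    "set_integrable lebesgue S (\<lambda>x. \<psi> x *\<^sub>R (G x $ i))"
    using test_function_continuous[OF \<psi>]
      bounded_bilinear_set_integrable[OF bounded_bilinear.comp1[OF bounded_bilinear_scaleR bounded_linear_vec_nth[of i]] S, of w D\<psi>]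
      bounded_bilinear_set_integrable[OF bounded_bilinear.comp1[OF bounded_bilinear.flip[OF bounded_bilinear_scaleR] bounded_linear_vec_nth[of i]] S, of G \<psi>]
    by auto
qed

lemma has_weak_gradient_add:
  assumes S: "open S" "bounded S" and w: "has_weak_gradient S w G" and u: "has_weak_gradient S u H"
  shows "has_weak_gradient S (\<lambda>x. w x + u x) (\<lambda>x. G x + H x)"
  unfolding has_weak_gradient_def
proof (intro conjI allI impI)
  fix \<psi> D\<psi> i assume \<psi>: "test_function S \<psi> D\<psi>"
  show "(LINT x:S|lebesgue. ((w x + u x) $ i) *\<^sub>R D\<psi> x) = - (LINT x:S|lebesgue. \<psi> x *\<^sub>R ((G x + H x) $ i))"
    using w u \<psi> weak_gradient_integrable[OF S w \<psi>, of i] weak_gradient_integrable[OF S u \<psi>, of i]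
    by (simp add: scaleR_add_left scaleR_add_right set_integral_add has_weak_gradient_def)
qed (use w u in \<open>auto simp: has_weak_gradient_def intro: square_integrable_add\<close>)

lemma has_weak_gradient_scaleR:
  assumes w: "has_weak_gradient S w G"
  shows "has_weak_gradient S (\<lambda>x. c *\<^sub>R w x) (\<lambda>x. c *\<^sub>R G x)"
  unfolding has_weak_gradient_def
proof (intro conjI allI impI)
  fix \<psi> D\<psi> i assume \<psi>: "test_function S \<psi> D\<psi>"
  have "(LINT x:S|lebesgue. (w x $ i) *\<^sub>R D\<psi> x) = - (LINT x:S|lebesgue. \<psi> x *\<^sub>R (G x $ i))"
    using w \<psi> unfolding has_weak_gradient_def by blast
  then have "(LINT x:S|lebesgue. c *\<^sub>R ((w x $ i) *\<^sub>R D\<psi> x)) = - (LINT x:S|lebesgue. c *\<^sub>R (\<psi> x *\<^sub>R (G x $ i)))"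
    by (simp only: set_integral_scaleR_right scaleR_minus_right)
  then show "(LINT x:S|lebesgue. ((c *\<^sub>R w x) $ i) *\<^sub>R D\<psi> x) = - (LINT x:S|lebesgue. \<psi> x *\<^sub>R ((c *\<^sub>R G x) $ i))"
    by (simp only: vector_scaleR_component real_scaleR_def scaleR_scaleR mult.commute[of c])
qed (use w in \<open>auto simp: has_weak_gradient_def intro: square_integrable_scaleR\<close>)

text \<open>For each row the difference of two weak gradients integrates to 0 against every test
  function. The finitely many exceptional null sets of the rows are then united.\<close>

lemma weak_gradient_unique:
  assumes S: "open S" "bounded S" and G: "has_weak_gradient S w G" and H: "has_weak_gradient S w H"
  shows "AE x in lebesgue. x \<in> S \<longrightarrow> G x = H x"
proof -
  have int: "set_integrable lebesgue S (\<lambda>x. F x $ i)" if "has_weak_gradient S w F" for F i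
  proof -
    have "set_integrable lebesgue S F"
      using that square_integrable_imp_set_integrable[OF S, of F] by (simp add: has_weak_gradient_def)
    then show ?thesis
      using integrable_bounded_linear[OF bounded_linear_vec_nth[of i], of lebesgue "\<lambda>x. indicat_real S x *\<^sub>R F x"]
      by (simp add: set_integrable_def)
  qed
  have "AE x in lebesgue. x \<in> S \<longrightarrow> G x $ i - H x $ i = 0" for i
  proof (rule du_Bois_Reymond[OF S])
    show "set_integrable lebesgue S (\<lambda>x. G x $ i - H x $ i)"
      using int G H by (intro set_integral_diff)
    fix \<psi> D\<psi> assume \<psi>: "test_function S \<psi> D\<psi>"
    then have "(LINT x:S|lebesgue. \<psi> x *\<^sub>R (G x $ i)) = (LINT x:S|lebesgue. \<psi> x *\<^sub>R (H x $ i))"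
      using G H by (metis (no_types, lifting) has_weak_gradient_def neg_equal_iff_equal)
    then show "(LINT x:S|lebesgue. \<psi> x *\<^sub>R (G x $ i - H x $ i)) = 0"
      using weak_gradient_integrable[OF S G \<psi>, of i] weak_gradient_integrable[OF S H \<psi>, of i]
      by (simp add: scaleR_diff_right set_integral_diff)
  qed
  then have "AE x in lebesgue. \<forall>i. x \<in> S \<longrightarrow> G x $ i - H x $ i = 0"
    by (subst AE_all_countable) blast
  then show ?thesis by eventually_elim (simp add: vec_eq_iff)
qed

section \<open>Weak gradients of piecewise linear functions\<close>

lemma lborel_integral_translate:
  fixes f :: "'a::euclidean_space \<Rightarrow> real"
  assumes "f \<in> borel_measurable borel"
  shows "(LINT x|lborel. f (x + c)) = (LINT x|lborel. f x)"
proof -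
  have "(LINT x|lborel. f x) = (LINT x|distr lborel borel ((+) c). f x)"
    by (simp add: lborel_distr_plus)
  also have "\<dots> = (LINT x|lborel. f (c + x))"
    using assms by (intro integral_distr) auto
  finally show ?thesis by (simp add: add.commute)
qed

lemma lborel_integrable_bounded_support:
  fixes f :: "'a::euclidean_space \<Rightarrow> real"
  assumes "f \<in> borel_measurable borel" "bounded S" "closed S"
    and "\<And>x. \<bar>f x\<bar> \<le> B" "\<And>x. x \<notin> S \<Longrightarrow> f x = 0"
  shows "integrable lborel f"
  by (rule integrableI_bounded_set[where A=S and B=B])
    (use assms emeasure_bounded_finite[of S] in auto)

text \<open>The complement of the support is open, so the gradient vanishes there together with the
  function. Integrals over the domain can therefore be taken over the whole space, where translation
  is available.\<close>

lemma test_function_outside: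
  assumes "test_function S \<psi> D\<psi>" "x \<notin> S"
  shows "\<psi> x = 0" "D\<psi> x = 0"
proof -
  define U where "U = - closure {x. \<psi> x \<noteq> 0}"
  have U: "open U" "x \<in> U" using assms by (auto simp: test_function_def U_def)
  have zero: "\<psi> y = 0" if "y \<in> U" for y
    using that closure_subset[of "{x. \<psi> x \<noteq> 0}"] by (auto simp: U_def)
  show "\<psi> x = 0" by (rule zero[OF U(2)])
  have "(\<psi> has_derivative (\<lambda>h. 0)) (at x)"
    by (rule has_derivative_transform_within_open[where f="\<lambda>_. 0" and s=U])
      (simp_all add: U zero)
  moreover have "(\<psi> has_derivative (\<lambda>h. h \<bullet> D\<psi> x)) (at x)"
    using assms by (simp add: test_function_def gderiv_def)
  ultimately have "(\<lambda>h. h \<bullet> D\<psi> x) = (\<lambda>h. 0)" by (rule has_derivative_unique[rotated])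
  then show "D\<psi> x = 0" by (metis inner_eq_zero_iff)
qed

text \<open>The gradient vanishes outside a bounded set, so it is bounded, and the mean value
  inequality on the whole space gives the Lipschitz bound. This bound dominates the difference
  quotients of the test function.\<close>

lemma test_function_bounds:
  assumes \<psi>: "test_function S \<psi> D\<psi>" and S: "bounded S"
  obtains B where "B \<ge> 0" "\<And>x. \<bar>\<psi> x\<bar> \<le> B" "\<And>x. norm (D\<psi> x) \<le> B"
    "\<And>x y. \<bar>\<psi> x - \<psi> y\<bar> \<le> B * norm (x - y)"
proof -
  have bdd: "\<exists>B\<ge>0. \<forall>x. norm (f x) \<le> B" if "continuous_on UNIV f" "\<And>x. x \<notin> S \<Longrightarrow> f x = 0"
    for f :: "real^3 \<Rightarrow> 'c::real_normed_vector"
  proof -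
    have "compact (f ` closure S)"
      using S that by (intro compact_continuous_image) (auto intro: continuous_on_subset)
    then obtain B where "\<And>x. x \<in> closure S \<Longrightarrow> norm (f x) \<le> B"
      using compact_imp_bounded bounded_iff by (metis imageI)
    then have "norm (f x) \<le> max B 0" for x
      using that(2)[of x] closure_subset[of S] by (cases "x \<in> S") (auto simp: le_max_iff_disj)
    then show ?thesis by (intro exI[of _ "max B 0"]) auto
  qed
  obtain B1 where B1: "B1 \<ge> 0" "\<And>x. norm (\<psi> x) \<le> B1"
    using bdd[OF test_function_continuous(1)[OF \<psi>] test_function_outside(1)[OF \<psi>]] by blast
  obtain B2 where B2: "B2 \<ge> 0" "\<And>x. norm (D\<psi> x) \<le> B2"
    using bdd[OF test_function_continuous(2)[OF \<psi>] test_function_outside(2)[OF \<psi>]] by blast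
  have lip: "norm (\<psi> x - \<psi> y) \<le> B2 * norm (x - y)" for x y
  proof (rule differentiable_bound[OF convex_UNIV])
    fix z
    show "(\<psi> has_derivative (\<lambda>h. h \<bullet> D\<psi> z)) (at z within UNIV)"
      using \<psi> by (simp add: test_function_def gderiv_def)
    have "norm (h \<bullet> D\<psi> z) \<le> B2 * norm h" for h
    proof -
      have "norm (h \<bullet> D\<psi> z) \<le> norm h * norm (D\<psi> z)" using Cauchy_Schwarz_ineq2 by simp
      also have "\<dots> \<le> norm h * B2" using B2 by (intro mult_left_mono) auto
      finally show ?thesis by (simp add: mult.commute)
    qed
    then show "onorm (\<lambda>h. h \<bullet> D\<psi> z) \<le> B2" by (rule onorm_le)
  qed auto
  show thesis
  proof (rule that[of "max B1 B2"])
    show "\<bar>\<psi> x - \<psi> y\<bar> \<le> max B1 B2 * norm (x - y)" for x y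
      using lip[of x y] mult_right_mono[of B2 "max B1 B2" "norm (x - y)"] by auto
  qed (use B1 B2 in \<open>auto simp: le_max_iff_disj\<close>)
qed

section \<open>Piecewise linear functions along segments and near almost every point\<close>

context tetrahedral_mesh begin

text \<open>A face that meets the interior of a convex set is the whole set; applied on both sides,
  the intersection equals each of the two elements.\<close>

lemma interior_element_disjoint:
  assumes K: "K \<in> \<T>" "K' \<in> \<T>" "x \<in> interior K" "x \<in> interior K'"
  shows "K = K'"
proof -
  have "K \<inter> K' = K"
    using face_of_disjoint_interior[OF mesh_Int_face[OF K(1,2)]] K interior_subset by blast
  moreover have "K' \<inter> K = K'"
    using face_of_disjoint_interior[OF mesh_Int_face[OF K(2,1)]] K interior_subset by blast
  ultimately show ?thesis by blast
qed

text \<open>The exceptional points lie on the boundaries of finitely many convex sets, each of which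
  is negligible.\<close>

lemma AE_in_interior_element: "AE x in lborel. x \<in> \<Omega> \<longrightarrow> (\<exists>K\<in>\<T>. x \<in> interior K)"
proof -
  have "AE x in lborel. x \<notin> frontier K" if "K \<in> \<T>" for K
    using negligible_convex_frontier[OF convex_element[OF that]]
    by (intro AE_not_in) (simp add: negligible_iff_null_sets null_sets_completion_iff)
  then have "AE x in lborel. \<forall>K\<in>\<T>. x \<notin> frontier K"
    using finite_mesh by (subst AE_ball_countable) (auto intro: countable_finite)
  then show ?thesis
  proof eventually_elim
    case (elim x)
    show ?case
    proof
      assume "x \<in> \<Omega>"
      then obtain K where "K \<in> \<T>" "x \<in> K" using Union_mesh closure_subset[of \<Omega>] by blast
      then show "\<exists>K\<in>\<T>. x \<in> interior K"
        using elim compact_element[THEN compact_imp_closed] by (auto simp: frontier_def)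
    qed
  qed
qed

text \<open>The elements cut the parameter interval into finitely many closed pieces on which
  \<open>u\<close> is affine, and Lipschitz bounds on a finite closed cover of an interval combine.
  The segment itself must stay in the closed domain, which need not be convex. The sum of the slopes
  serves as one constant for all elements.\<close>

lemma P1_lipschitz_on_segment:
  assumes u: "\<And>K x. K \<in> \<T> \<Longrightarrow> x \<in> K \<Longrightarrow> u x = a K \<bullet> x + b K"
    and seg: "closed_segment x y \<subseteq> closure \<Omega>"
  shows "\<bar>u y - u x\<bar> \<le> (\<Sum>K\<in>\<T>. norm (a K)) * norm (y - x)"
proof -
  let ?M = "(\<Sum>K\<in>\<T>. norm (a K)) * norm (y - x)"
  let ?l = "\<lambda>t::real. x + t *\<^sub>R (y - x)"
  have "?M-lipschitz_on {0..1} (\<lambda>t. u (?l t))"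
  proof (rule lipschitz_on_closed_Union[where I=\<T> and U="\<lambda>K. ?l -` K"])
    fix K assume K: "K \<in> \<T>"
    show "closed (?l -` K)"
      using compact_element[OF K, THEN compact_imp_closed] by (intro closed_vimage continuous_intros)
    show "?M-lipschitz_on (?l -` K) (\<lambda>t. u (?l t))"
    proof (rule lipschitz_onI)
      fix s t assume "s \<in> ?l -` K" "t \<in> ?l -` K"
      then have "u (?l s) - u (?l t) = (s - t) * (a K \<bullet> (y - x))"
        using u[OF K] by (simp add: inner_add_right algebra_simps)
      then have "dist (u (?l s)) (u (?l t)) = \<bar>s - t\<bar> * \<bar>a K \<bullet> (y - x)\<bar>"
        by (simp add: dist_real_def abs_mult)
      also have "\<dots> \<le> \<bar>s - t\<bar> * (norm (a K) * norm (y - x))"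
        by (intro mult_left_mono Cauchy_Schwarz_ineq2) auto
      also have "\<dots> \<le> \<bar>s - t\<bar> * ?M"
        using member_le_sum[OF K, of "\<lambda>K. norm (a K)"] finite_mesh
        by (intro mult_left_mono mult_right_mono) auto
      finally show "dist (u (?l s)) (u (?l t)) \<le> ?M * dist s t"
        by (simp add: dist_real_def mult.commute)
    qed (auto intro!: mult_nonneg_nonneg sum_nonneg)
  next
    show "{0..1} \<subseteq> (\<Union>K\<in>\<T>. ?l -` K)"
    proof
      fix t :: real assume "t \<in> {0..1}"
      then have "?l t \<in> closed_segment x y"
        by (auto simp: closed_segment_def algebra_simps intro!: exI[of _ t])
      then show "t \<in> (\<Union>K\<in>\<T>. ?l -` K)" using seg Union_mesh by blast
    qed
  qed (use finite_mesh in \<open>auto intro!: mult_nonneg_nonneg sum_nonneg\<close>)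
  then have "dist (u (?l 1)) (u (?l 0)) \<le> ?M * dist 1 (0::real)" by (rule lipschitz_onD) auto
  then show ?thesis by (simp add: dist_real_def)
qed

text \<open>The elementwise gradient for slopes \<open>a\<close>. The interiors are disjoint, so at
  most one summand is nonzero; on element boundaries, a null set, the value is 0. A sum of
  indicators is Borel measurable at once.\<close>

definition piecewise_const :: "((real^3) set \<Rightarrow> real^3) \<Rightarrow> real^3 \<Rightarrow> real^3" where
  "piecewise_const a x = (\<Sum>K\<in>\<T>. indicator (interior K) x *\<^sub>R a K)"

lemma piecewise_const_interior:
  assumes "K \<in> \<T>" "x \<in> interior K" shows "piecewise_const a x = a K"
proof -
  have "piecewise_const a x = (\<Sum>K'\<in>\<T>. if K' = K then a K else 0)"
    unfolding piecewise_const_def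
    using assms interior_element_disjoint by (intro sum.cong) (auto simp: indicator_def)
  then show ?thesis using assms finite_mesh by simp
qed

lemma piecewise_const_borel [measurable]: "piecewise_const a \<in> borel_measurable borel"
proof -
  have "(\<lambda>x. \<Sum>K\<in>\<T>. indicator (interior K) x *\<^sub>R a K) \<in> borel_measurable borel"
    by (intro borel_measurable_sum borel_measurable_scaleR borel_measurable_indicator) auto
  then show ?thesis by (simp add: piecewise_const_def[abs_def])
qed

lemma piecewise_const_bound: "norm (piecewise_const a x) \<le> (\<Sum>K\<in>\<T>. norm (a K))"
  unfolding piecewise_const_def by (intro sum_norm_le) (auto simp: indicator_def)

text \<open>
  Discrete integration by parts moves the difference quotient in direction \<open>e\<close> from \<open>\<psi>\<close> to \<open>u\<close>
  by translation invariance. Both sides converge by dominated convergence: \<open>u\<close> is Lipschitz along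
  segments inside the domain and affine near almost every point.
\<close>

lemma P1_integration_by_parts:
  assumes uP: "u \<in> P1 \<Omega> \<T>" and u: "\<And>K x. K \<in> \<T> \<Longrightarrow> x \<in> K \<Longrightarrow> u x = a K \<bullet> x + b K"
    and \<psi>: "test_function \<Omega> \<psi> D\<psi>" and e: "norm e = 1"
  shows "(LINT x|lborel. u x * (e \<bullet> D\<psi> x)) = - (LINT x|lborel. \<psi> x * (e \<bullet> piecewise_const a x))"
proof -
  let ?S = "closure {x. \<psi> x \<noteq> 0}"
  have "compact ?S" "?S \<subseteq> \<Omega>" using \<psi> by (auto simp: test_function_def)
  then obtain d where d: "d > 0" "(\<Union>x\<in>?S. ball x d) \<subseteq> \<Omega>"
    using compact_subset_open_imp_ball_epsilon_subset open_domain by metis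
  \<comment> \<open>Positive shifts tending to 0 and strictly below \<open>d\<close>, also for n = 0
    because of the 2, so that shifted points of the support remain in the domain.\<close>
  define t where "t n = d / real (n + 2)" for n
  have t: "t n > 0" "t n < d" for n
    using d(1) by (auto simp: t_def field_simps add_pos_nonneg)
  have t0: "t \<longlonglongrightarrow> 0"
    unfolding t_def using LIMSEQ_ignore_initial_segment[OF lim_const_over_n[of d], of 2] by simp
  obtain B where B: "B \<ge> 0" "\<And>x. \<bar>\<psi> x\<bar> \<le> B" "\<And>x. norm (D\<psi> x) \<le> B"
    "\<And>x y. \<bar>\<psi> x - \<psi> y\<bar> \<le> B * norm (x - y)"
    using test_function_bounds[OF \<psi> bounded_domain] by blast
  obtain C where C: "\<And>x. \<bar>u x\<bar> \<le> C" using P1_bounded[OF uP] by blast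
  have C0: "C \<ge> 0" using C[of 0] by linarith
  let ?M = "\<Sum>K\<in>\<T>. norm (a K)"
  have M0: "?M \<ge> 0" by (intro sum_nonneg) auto
  have um: "u \<in> borel_measurable borel" using P1_borel[OF uP] .
  have \<psi>m: "\<psi> \<in> borel_measurable borel" "D\<psi> \<in> borel_measurable borel"
    using test_function_continuous[OF \<psi>] by (auto intro: borel_measurable_continuous_onI)
  note [measurable] = um \<psi>m
  have bc: "bounded (closure \<Omega>)" using bounded_domain by (rule bounded_closure)
  have ind: "integrable lborel (\<lambda>x. c * indicat_real (closure \<Omega>) x)" for c
    using emeasure_bounded_finite[OF bc] by (intro integrable_mult_right) auto
  have \<psi>0: "\<psi> x = 0" if "x \<notin> \<Omega>" for x using test_function_outside[OF \<psi> that] by simp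
  have u0: "u x = 0" if "x \<notin> closure \<Omega>" for x using P1_outside[OF uP that] .
  define L where "L n = (LINT x|lborel. u x * ((\<psi> (x + t n *\<^sub>R e) - \<psi> x) / t n))" for n
  define R where "R n = (LINT x|lborel. \<psi> x * ((u (x - t n *\<^sub>R e) - u x) / t n))" for n
  have LR: "L n = R n" for n
  proof -
    have b: "\<bar>u x * \<psi> y\<bar> \<le> C * B" for x y
      unfolding abs_mult using C B C0 by (intro mult_mono) auto
    have i1: "integrable lborel (\<lambda>x. u x * \<psi> (x + t n *\<^sub>R e))"
      by (rule lborel_integrable_bounded_support[OF _ bc]) (use b u0 in auto)
    have i2: "integrable lborel (\<lambda>x. u x * \<psi> x)"
      by (rule lborel_integrable_bounded_support[OF _ bc]) (use b u0 in auto)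
    have i3: "integrable lborel (\<lambda>x. u (x - t n *\<^sub>R e) * \<psi> x)"
      by (rule lborel_integrable_bounded_support[OF _ bc]) (use b \<psi>0 closure_subset[of \<Omega>] in auto)
    have "L n = ((LINT x|lborel. u x * \<psi> (x + t n *\<^sub>R e)) - (LINT x|lborel. u x * \<psi> x)) / t n"
      unfolding L_def using i1 i2 by (simp add: right_diff_distrib Bochner_Integration.integral_diff)
    also have "(LINT x|lborel. u x * \<psi> (x + t n *\<^sub>R e)) = (LINT x|lborel. u (x - t n *\<^sub>R e) * \<psi> x)"
      using lborel_integral_translate[of "\<lambda>x. u (x - t n *\<^sub>R e) * \<psi> x" "t n *\<^sub>R e"] by simp
    also have "((LINT x|lborel. u (x - t n *\<^sub>R e) * \<psi> x) - (LINT x|lborel. u x * \<psi> x)) / t n = R n"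
      unfolding R_def using i3 i2
      by (simp add: right_diff_distrib Bochner_Integration.integral_diff mult.commute)
    finally show ?thesis .
  qed
  have "L \<longlonglongrightarrow> (LINT x|lborel. u x * (e \<bullet> D\<psi> x))"
    unfolding L_def
  proof (rule integral_dominated_convergence[OF _ _ ind[of "C * B"]])
    show "AE x in lborel. (\<lambda>n. u x * ((\<psi> (x + t n *\<^sub>R e) - \<psi> x) / t n)) \<longlonglongrightarrow> u x * (e \<bullet> D\<psi> x)"
    proof (intro AE_I2 tendsto_mult tendsto_const)
      fix x
      have 1: "(\<psi> has_derivative (\<lambda>h. h \<bullet> D\<psi> x)) (at (x + 0 *\<^sub>R e))"
        using \<psi> by (simp add: test_function_def gderiv_def)
      have "((\<lambda>s. \<psi> (x + s *\<^sub>R e)) has_derivative (\<lambda>s. (s *\<^sub>R e) \<bullet> D\<psi> x)) (at 0)"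
        by (rule has_derivative_compose[where f="\<lambda>s. x + s *\<^sub>R e" and g=\<psi> and x=0, OF _ 1])
          (auto intro!: derivative_eq_intros)
      then have "((\<lambda>s. \<psi> (x + s *\<^sub>R e)) has_real_derivative e \<bullet> D\<psi> x) (at 0)"
        by (simp add: has_field_derivative_def mult_commute_abs)
      then have "(\<lambda>h. (\<psi> (x + h *\<^sub>R e) - \<psi> x) / h) \<midarrow>0\<rightarrow> e \<bullet> D\<psi> x"
        by (simp add: DERIV_def)
      then show "(\<lambda>n. (\<psi> (x + t n *\<^sub>R e) - \<psi> x) / t n) \<longlonglongrightarrow> e \<bullet> D\<psi> x"
        by (rule filterlim_compose) (use t0 t(1) in \<open>simp add: filterlim_at less_imp_neq[symmetric]\<close>)
    qed
    show "AE x in lborel. norm (u x * ((\<psi> (x + t n *\<^sub>R e) - \<psi> x) / t n)) \<le> C * B * indicat_real (closure \<Omega>) x" for n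
    proof (intro AE_I2)
      fix x
      have "\<bar>(\<psi> (x + t n *\<^sub>R e) - \<psi> x) / t n\<bar> \<le> B"
        using B(4)[of "x + t n *\<^sub>R e" x] t(1)[of n] e by (simp add: field_simps)
      then have "\<bar>u x * ((\<psi> (x + t n *\<^sub>R e) - \<psi> x) / t n)\<bar> \<le> C * B"
        unfolding abs_mult using C C0 by (intro mult_mono) auto
      then show "norm (u x * ((\<psi> (x + t n *\<^sub>R e) - \<psi> x) / t n)) \<le> C * B * indicat_real (closure \<Omega>) x"
        using u0[of x] by (cases "x \<in> closure \<Omega>") auto
    qed
  qed measurable
  moreover have "R \<longlonglongrightarrow> (LINT x|lborel. - (\<psi> x * (e \<bullet> piecewise_const a x)))"
    unfolding R_def
  proof (rule integral_dominated_convergence[OF _ _ ind[of "B * ?M"]])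
    show "AE x in lborel. (\<lambda>n. \<psi> x * ((u (x - t n *\<^sub>R e) - u x) / t n)) \<longlonglongrightarrow> - (\<psi> x * (e \<bullet> piecewise_const a x))"
      using AE_in_interior_element
    proof eventually_elim
      case (elim x)
      show ?case
      proof (cases "x \<in> \<Omega>")
        case True
        then obtain K where K: "K \<in> \<T>" "x \<in> interior K" using elim by blast
        have "(\<lambda>n. x - t n *\<^sub>R e) \<longlonglongrightarrow> x - 0 *\<^sub>R e" by (intro tendsto_intros t0)
        then have "\<forall>\<^sub>F n in sequentially. x - t n *\<^sub>R e \<in> interior K"
          using K(2) by (intro topological_tendstoD) auto
        \<comment> \<open>Once the shifted point lies in the element of \<open>x\<close>, the
          quotient equals its limit exactly: the sequence is eventually constant.\<close>
        then have "\<forall>\<^sub>F n in sequentially. \<psi> x * ((u (x - t n *\<^sub>R e) - u x) / t n) = - (\<psi> x * (e \<bullet> piecewise_const a x))"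
        proof eventually_elim
          case (elim n)
          then have "u (x - t n *\<^sub>R e) - u x = - t n * (e \<bullet> a K)"
            using u[OF K(1)] K(2) interior_subset[of K]
            by (auto simp: subset_iff inner_diff_right inner_commute)
          then show ?case using t(1)[of n] piecewise_const_interior[OF K] by simp
        qed
        then show ?thesis by (rule tendsto_eventually)
      qed (simp add: \<psi>0)
    qed
    show "AE x in lborel. norm (\<psi> x * ((u (x - t n *\<^sub>R e) - u x) / t n)) \<le> B * ?M * indicat_real (closure \<Omega>) x" for n
    proof (intro AE_I2)
      fix x
      show "norm (\<psi> x * ((u (x - t n *\<^sub>R e) - u x) / t n)) \<le> B * ?M * indicat_real (closure \<Omega>) x"
      \<comment> \<open>Off the support the factor \<psi> removes the quotient, however badly
        \<open>u\<close> jumps to 0 across the boundary. On the support the whole segment lies in a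
        ball inside the domain, where the Lipschitz bound applies.\<close>
      proof (cases "\<psi> x = 0")
        case True
        then show ?thesis using B(1) M0 by simp
      next
        case False
        then have x: "x \<in> ?S" "x \<in> \<Omega>" using closure_subset[of "{x. \<psi> x \<noteq> 0}"] \<psi>0[of x] by auto
        have "x - t n *\<^sub>R e \<in> ball x d" "x \<in> ball x d" using t[of n] e d(1) by (auto simp: dist_norm)
        then have "closed_segment x (x - t n *\<^sub>R e) \<subseteq> ball x d"
          by (intro closed_segment_subset convex_ball)
        then have "closed_segment x (x - t n *\<^sub>R e) \<subseteq> closure \<Omega>" using d(2) x(1) closure_subset[of \<Omega>] by blast
        from P1_lipschitz_on_segment[OF u this]
        have "\<bar>(u (x - t n *\<^sub>R e) - u x) / t n\<bar> \<le> ?M"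
          using t(1)[of n] e by (simp add: field_simps)
        then have "\<bar>\<psi> x * ((u (x - t n *\<^sub>R e) - u x) / t n)\<bar> \<le> B * ?M"
          unfolding abs_mult using B by (intro mult_mono) auto
        then show ?thesis using x(2) closure_subset[of \<Omega>] by (auto simp: indicator_def)
      qed
    qed
  qed measurable
  moreover have "L = R" using LR by (rule ext)
  ultimately show ?thesis using LIMSEQ_unique by fastforce
qed

text \<open>Reduces to integration by parts along each unit vector: \<psi> and its gradient vanish
  outside the domain, and Borel functions have the same integral for \<open>lborel\<close> and its
  completion.\<close>

lemma P1_has_weak_partial:
  assumes uP: "u \<in> P1 \<Omega> \<T>" and u: "\<And>K x. K \<in> \<T> \<Longrightarrow> x \<in> K \<Longrightarrow> u x = a K \<bullet> x + b K"
    and \<psi>: "test_function \<Omega> \<psi> D\<psi>"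
  shows "(LINT x:\<Omega>|lebesgue. u x *\<^sub>R D\<psi> x) = - (LINT x:\<Omega>|lebesgue. \<psi> x *\<^sub>R piecewise_const a x)"
    (is "?I = - ?J")
proof (rule euclidean_eqI)
  fix e :: "real^3" assume e: "e \<in> Basis"
  note S = open_domain bounded_domain
  have \<psi>m: "\<psi> \<in> borel_measurable borel" "D\<psi> \<in> borel_measurable borel"
    using test_function_continuous[OF \<psi>] by (auto intro: borel_measurable_continuous_onI)
  note [measurable] = P1_borel[OF uP] \<psi>m
  obtain C where C: "\<And>x. \<bar>u x\<bar> \<le> C" using P1_bounded[OF uP] by blast
  have "square_integrable \<Omega> u" "square_integrable \<Omega> (piecewise_const a)"
    using C piecewise_const_bound P1_borel[OF uP]
    by (auto intro!: square_integrable_bounded[OF S])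
  then have int: "set_integrable lebesgue \<Omega> u" "set_integrable lebesgue \<Omega> (piecewise_const a)"
    by (auto intro: square_integrable_imp_set_integrable[OF S])
  have i1: "set_integrable lebesgue \<Omega> (\<lambda>x. u x *\<^sub>R D\<psi> x)"
    by (rule bounded_bilinear_set_integrable[OF bounded_bilinear_scaleR S int(1) test_function_continuous(2)[OF \<psi>]])
  have i2: "set_integrable lebesgue \<Omega> (\<lambda>x. \<psi> x *\<^sub>R piecewise_const a x)"
    by (rule bounded_bilinear_set_integrable[OF bounded_bilinear.flip[OF bounded_bilinear_scaleR] S int(2) test_function_continuous(1)[OF \<psi>]])
  have "?I \<bullet> e = (LINT x|lebesgue. (indicator \<Omega> x *\<^sub>R u x *\<^sub>R D\<psi> x) \<bullet> e)"
    using i1 unfolding set_lebesgue_integral_def set_integrable_def by (intro integral_inner_left[symmetric])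
  also have "\<dots> = (LINT x|lebesgue. u x * (e \<bullet> D\<psi> x))"
    by (intro Bochner_Integration.integral_cong)
      (auto simp: indicator_def inner_commute test_function_outside[OF \<psi>])
  also have "\<dots> = (LINT x|lborel. u x * (e \<bullet> D\<psi> x))" by (rule integral_completion) measurable
  also have "\<dots> = - (LINT x|lborel. \<psi> x * (e \<bullet> piecewise_const a x))"
    using P1_integration_by_parts[OF uP u \<psi>] e by simp
  also have "(LINT x|lborel. \<psi> x * (e \<bullet> piecewise_const a x)) = (LINT x|lebesgue. \<psi> x * (e \<bullet> piecewise_const a x))"
    by (rule integral_completion[symmetric]) measurable
  also have "\<dots> = (LINT x|lebesgue. (indicator \<Omega> x *\<^sub>R \<psi> x *\<^sub>R piecewise_const a x) \<bullet> e)"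
    by (intro Bochner_Integration.integral_cong)
      (auto simp: indicator_def inner_commute test_function_outside[OF \<psi>])
  also have "\<dots> = ?J \<bullet> e"
    using i2 unfolding set_lebesgue_integral_def set_integrable_def by (intro integral_inner_left)
  finally show "?I \<bullet> e = (- ?J) \<bullet> e" by simp
qed

text \<open>Gives the choice operator in \<open>weak_gradient\<close> an actual witness on the
  finite element space.\<close>

lemma P1_vec_has_weak_gradient:
  assumes w: "w \<in> P1_vec \<Omega> \<T>" shows "\<exists>G. has_weak_gradient \<Omega> w G"
proof -
  note S = open_domain bounded_domain
  have wP: "(\<lambda>x. w x $ i) \<in> P1 \<Omega> \<T>" for i using w by (simp add: P1_vec_def)
  have "\<forall>i. \<forall>K\<in>\<T>. \<exists>a b. \<forall>x\<in>K. w x $ i = a \<bullet> x + b"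
    using P1_affineE[OF wP] by metis
  then obtain a b where ab: "\<And>i K x. K \<in> \<T> \<Longrightarrow> x \<in> K \<Longrightarrow> w x $ i = a i K \<bullet> x + b i K"
    by metis
  define G where "G x = (\<chi> i. piecewise_const (a i) x)" for x
  have "square_integrable \<Omega> G"
  proof (rule square_integrable_bounded[OF S])
    show "G \<in> borel_measurable borel"
      unfolding G_def by (rule borel_measurable_vec) simp
    show "norm (G x) \<le> (\<Sum>i\<in>UNIV. \<Sum>K\<in>\<T>. norm (a i K))" for x
    proof -
      have "norm (G x) \<le> (\<Sum>i\<in>UNIV. norm (G x $ i))"
        unfolding norm_vec_def by (intro L2_set_le_sum) auto
      also have "\<dots> \<le> (\<Sum>i\<in>UNIV. \<Sum>K\<in>\<T>. norm (a i K))"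
        by (intro sum_mono) (simp add: G_def piecewise_const_bound)
      finally show ?thesis .
    qed
  qed
  moreover
  have "\<forall>i. \<exists>B. \<forall>x. \<bar>w x $ i\<bar> \<le> B" using P1_bounded[OF wP] by blast
  then obtain B where B: "\<And>i x. \<bar>w x $ i\<bar> \<le> B i" by metis
  have "square_integrable \<Omega> w"
  proof (rule square_integrable_bounded[OF S])
    show "norm (w x) \<le> (\<Sum>i\<in>UNIV. B i)" for x
      using order.trans[OF norm_le_l1_cart sum_mono[of UNIV "\<lambda>i. \<bar>w x $ i\<bar>" B]] B by blast
    show "w \<in> borel_measurable borel"
      using P1_borel[OF wP] by (rule borel_measurable_vec)
  qed
  moreover have "(LINT x:\<Omega>|lebesgue. (w x $ i) *\<^sub>R D\<psi> x) = - (LINT x:\<Omega>|lebesgue. \<psi> x *\<^sub>R (G x $ i))"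
    if "test_function \<Omega> \<psi> D\<psi>" for \<psi> D\<psi> i
    using P1_has_weak_partial[OF wP ab that] by (simp add: G_def)
  ultimately show ?thesis unfolding has_weak_gradient_def by blast
qed

end

section \<open>The discrete Laplacian\<close>

context tetrahedral_mesh begin

abbreviation "V \<equiv> P1_vec \<Omega> \<T>"
abbreviation "\<Delta> \<equiv> discrete_laplacian \<Omega> \<T>"

lemma P1_add:
  assumes u: "u \<in> P1 \<Omega> \<T>" and w: "w \<in> P1 \<Omega> \<T>" shows "(\<lambda>x. u x + w x) \<in> P1 \<Omega> \<T>"
proof -
  have "\<exists>a b. \<forall>x\<in>K. u x + w x = a \<bullet> x + b" if K: "K \<in> \<T>" for K
  proof -
    obtain a b where "\<And>x. x \<in> K \<Longrightarrow> u x = a \<bullet> x + b" using P1_affineE[OF u K] by blast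
    moreover obtain a' b' where "\<And>x. x \<in> K \<Longrightarrow> w x = a' \<bullet> x + b'" using P1_affineE[OF w K] by blast
    ultimately have "\<forall>x\<in>K. u x + w x = (a + a') \<bullet> x + (b + b')" by (simp add: inner_add_left)
    then show ?thesis by blast
  qed
  then show ?thesis using u w by (auto simp: P1_def intro: continuous_on_add)
qed

lemma P1_mult:
  assumes u: "u \<in> P1 \<Omega> \<T>" shows "(\<lambda>x. c * u x) \<in> P1 \<Omega> \<T>"
proof -
  have "\<exists>a b. \<forall>x\<in>K. c * u x = a \<bullet> x + b" if K: "K \<in> \<T>" for K
  proof -
    obtain a b where "\<And>x. x \<in> K \<Longrightarrow> u x = a \<bullet> x + b" using P1_affineE[OF u K] by blast
    then have "\<forall>x\<in>K. c * u x = (c *\<^sub>R a) \<bullet> x + c * b" by (simp add: distrib_left)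
    then show ?thesis by blast
  qed
  then show ?thesis using u by (auto simp: P1_def intro: continuous_on_mult_left)
qed

lemma P1_vec_add: "u \<in> V \<Longrightarrow> w \<in> V \<Longrightarrow> (\<lambda>x. u x + w x) \<in> V"
  by (simp add: P1_vec_def P1_add)

lemma P1_vec_scaleR: "u \<in> V \<Longrightarrow> (\<lambda>x. c *\<^sub>R u x) \<in> V"
  by (simp add: P1_vec_def P1_mult)

lemma P1_vec_zero: "(\<lambda>x. 0) \<in> V"
  by (auto simp: P1_vec_def P1_def intro!: exI[of _ 0])

lemma P1_vec_sum: "finite I \<Longrightarrow> (\<And>j. j \<in> I \<Longrightarrow> u j \<in> V) \<Longrightarrow> (\<lambda>x. \<Sum>j\<in>I. u j x) \<in> V"
  by (induction I rule: finite_induct) (auto simp: P1_vec_zero P1_vec_add)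

lemma P1_vec_eqI:
  assumes "u \<in> V" "w \<in> V" "\<And>z. z \<in> \<N> \<Longrightarrow> u z = w z"
  shows "u = w"
proof -
  have "(\<lambda>x. u x $ i) = (\<lambda>x. w x $ i)" for i
    using assms by (intro P1_eqI) (auto simp: P1_vec_def)
  then show ?thesis by (auto simp: fun_eq_iff vec_eq_iff)
qed

definition vec_interpolant :: "(real^3 \<Rightarrow> real^3) \<Rightarrow> real^3 \<Rightarrow> real^3" where
  "vec_interpolant g x = (\<chi> i. interpolant (\<lambda>z. g z $ i) x)"

lemma vec_interpolant_P1_vec: "vec_interpolant g \<in> V"
  by (simp add: P1_vec_def vec_interpolant_def interpolant_P1)

lemma vec_interpolant_node: "z \<in> \<N> \<Longrightarrow> vec_interpolant g z = g z"
  by (simp add: vec_interpolant_def interpolant_node vec_eq_iff)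

text \<open>For a node \<open>z\<close>, component \<open>i\<close> is the hat function of
  \<open>z\<close> and the other two vanish. The pairs (z, i) with \<open>z\<close> a node enumerate
  the degrees of freedom.\<close>

definition vec_basis :: "(real^3) \<times> 3 \<Rightarrow> real^3 \<Rightarrow> real^3" where
  "vec_basis = (\<lambda>(z, i). vec_interpolant (\<lambda>z'. if z' = z then axis i 1 else 0))"

lemma vec_basis_P1_vec: "vec_basis s \<in> V"
  by (simp add: vec_basis_def split_beta vec_interpolant_P1_vec)

lemma vec_basis_node: "z' \<in> \<N> \<Longrightarrow> vec_basis (z, i) z' = (if z' = z then axis i 1 else 0)"
  by (simp add: vec_basis_def vec_interpolant_node)

lemma P1_vec_expansion:
  assumes u: "u \<in> V"
  shows "u = (\<lambda>x. \<Sum>s\<in>\<N> \<times> UNIV. (u (fst s) $ snd s) *\<^sub>R vec_basis s x)"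
proof (rule P1_vec_eqI[OF u])
  show "(\<lambda>x. \<Sum>s\<in>\<N> \<times> UNIV. (u (fst s) $ snd s) *\<^sub>R vec_basis s x) \<in> V"
    using finite_nodes by (intro P1_vec_sum P1_vec_scaleR vec_basis_P1_vec) auto
  fix z assume z: "z \<in> \<N>"
  have "(\<Sum>s\<in>\<N> \<times> UNIV. (u (fst s) $ snd s) *\<^sub>R vec_basis s z) =
      (\<Sum>z'\<in>\<N>. \<Sum>i\<in>UNIV. (u z' $ i) *\<^sub>R vec_basis (z', i) z)"
    by (simp add: sum.cartesian_product split_beta)
  also have "\<dots> = (\<Sum>z'\<in>\<N>. if z' = z then u z else 0)"
    using z by (intro sum.cong) (auto simp: vec_basis_node basis_expansion simp flip: scalar_mult_eq_scaleR)
  also have "\<dots> = u z" using z finite_nodes by simp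
  finally show "u z = (\<Sum>s\<in>\<N> \<times> UNIV. (u (fst s) $ snd s) *\<^sub>R vec_basis s z)" ..
qed

text \<open>Mass lumping makes the mass matrix diagonal, so testing with a basis function isolates a
  single nodal component. Only nodal values of \<open>f\<close> enter; it need not be piecewise
  linear.\<close>

lemma lumped_inner_vec_basis:
  assumes z: "z \<in> \<N>"
  shows "lumped_inner \<Omega> \<T> f (vec_basis (z, i)) = node_weight \<Omega> \<T> z * (f z $ i)"
proof -
  have "lumped_inner \<Omega> \<T> f (vec_basis (z, i)) =
      (\<Sum>z'\<in>\<N>. if z' = z then node_weight \<Omega> \<T> z * (f z $ i) else 0)"
    unfolding lumped_inner_def by (intro sum.cong) (auto simp: vec_basis_node inner_axis)
  then show ?thesis using z finite_nodes by simp
qed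

section \<open>Bilinearity of the Dirichlet form\<close>

definition dirichlet_form :: "(real^3 \<Rightarrow> real^3) \<Rightarrow> (real^3 \<Rightarrow> real^3) \<Rightarrow> real" where
  "dirichlet_form w u = L2_inner \<Omega> (weak_gradient \<Omega> w) (weak_gradient \<Omega> u)"

lemma dirichlet_form_commute: "dirichlet_form w u = dirichlet_form u w"
  by (simp add: dirichlet_form_def L2_inner_def inner_commute)

lemma dirichlet_form_nonneg: "dirichlet_form w w \<ge> 0"
  unfolding dirichlet_form_def L2_inner_def set_lebesgue_integral_def
  by (intro Bochner_Integration.integral_nonneg) simp

lemma weak_gradient: "w \<in> V \<Longrightarrow> has_weak_gradient \<Omega> w (weak_gradient \<Omega> w)"
  unfolding weak_gradient_def using P1_vec_has_weak_gradient by (rule someI_ex)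

lemma L2_inner_integrable:
  "has_weak_gradient \<Omega> w G \<Longrightarrow> has_weak_gradient \<Omega> u H \<Longrightarrow> set_integrable lebesgue \<Omega> (\<lambda>x. G x \<bullet> H x)"
  by (intro square_integrable_inner) (auto simp: has_weak_gradient_def)

text \<open>Frees the form from the chosen representatives. The sum of two chosen gradients is a
  weak gradient of the sum, though not necessarily the chosen one; additivity and homogeneity of the
  form rest on this exchange.\<close>

lemma dirichlet_form_eq:
  assumes G: "has_weak_gradient \<Omega> w G" and H: "has_weak_gradient \<Omega> u H"
  shows "dirichlet_form w u = L2_inner \<Omega> G H"
  unfolding dirichlet_form_def L2_inner_def set_lebesgue_integral_def
proof (rule integral_cong_AE)
  note S = open_domain bounded_domain
  have w: "has_weak_gradient \<Omega> w (weak_gradient \<Omega> w)"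
    unfolding weak_gradient_def by (rule someI[of "has_weak_gradient \<Omega> w", OF G])
  have u: "has_weak_gradient \<Omega> u (weak_gradient \<Omega> u)"
    unfolding weak_gradient_def by (rule someI[of "has_weak_gradient \<Omega> u", OF H])
  show "(\<lambda>x. indicat_real \<Omega> x *\<^sub>R (weak_gradient \<Omega> w x \<bullet> weak_gradient \<Omega> u x)) \<in> borel_measurable lebesgue"
    using L2_inner_integrable[OF w u] unfolding set_integrable_def by (rule borel_measurable_integrable)
  show "(\<lambda>x. indicat_real \<Omega> x *\<^sub>R (G x \<bullet> H x)) \<in> borel_measurable lebesgue"
    using L2_inner_integrable[OF G H] unfolding set_integrable_def by (rule borel_measurable_integrable)
  show "AE x in lebesgue. indicat_real \<Omega> x *\<^sub>R (weak_gradient \<Omega> w x \<bullet> weak_gradient \<Omega> u x)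
      = indicat_real \<Omega> x *\<^sub>R (G x \<bullet> H x)"
    using weak_gradient_unique[OF S w G] weak_gradient_unique[OF S u H]
    by eventually_elim (simp add: indicator_def)
qed

lemma dirichlet_form_add_left:
  assumes w: "w \<in> V" and w': "w' \<in> V" and u: "u \<in> V"
  shows "dirichlet_form (\<lambda>x. w x + w' x) u = dirichlet_form w u + dirichlet_form w' u"
proof -
  note G = weak_gradient[OF w] weak_gradient[OF w'] weak_gradient[OF u]
  have "dirichlet_form (\<lambda>x. w x + w' x) u =
      L2_inner \<Omega> (\<lambda>x. weak_gradient \<Omega> w x + weak_gradient \<Omega> w' x) (weak_gradient \<Omega> u)"
    by (rule dirichlet_form_eq[OF has_weak_gradient_add[OF open_domain bounded_domain G(1,2)] G(3)])
  also have "\<dots> = dirichlet_form w u + dirichlet_form w' u"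
    unfolding dirichlet_form_def L2_inner_def inner_add_left
    by (rule set_integral_add(2)[OF L2_inner_integrable[OF G(1,3)] L2_inner_integrable[OF G(2,3)]])
  finally show ?thesis .
qed

lemma dirichlet_form_scaleR_left:
  assumes w: "w \<in> V" and u: "u \<in> V"
  shows "dirichlet_form (\<lambda>x. c *\<^sub>R w x) u = c * dirichlet_form w u"
proof -
  note G = weak_gradient[OF w] weak_gradient[OF u]
  have "dirichlet_form (\<lambda>x. c *\<^sub>R w x) u = L2_inner \<Omega> (\<lambda>x. c *\<^sub>R weak_gradient \<Omega> w x) (weak_gradient \<Omega> u)"
    by (rule dirichlet_form_eq[OF has_weak_gradient_scaleR[OF G(1)] G(2)])
  then show ?thesis by (simp add: dirichlet_form_def L2_inner_def)
qed

lemma dirichlet_form_sum_right: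
  assumes w: "w \<in> V" and "finite I" "\<And>j. j \<in> I \<Longrightarrow> u j \<in> V"
  shows "dirichlet_form w (\<lambda>x. \<Sum>j\<in>I. c j *\<^sub>R u j x) = (\<Sum>j\<in>I. c j * dirichlet_form w (u j))"
  using assms(2,3)
proof (induction I rule: finite_induct)
  case empty
  \<comment> \<open>The empty sum is the zero function, treated as 0 times itself so that
    homogeneity applies.\<close>
  show ?case using dirichlet_form_scaleR_left[OF P1_vec_zero w, of 0] dirichlet_form_commute by simp
next
  case (insert j I)
  have "dirichlet_form w (\<lambda>x. \<Sum>j\<in>insert j I. c j *\<^sub>R u j x) =
      dirichlet_form (\<lambda>x. c j *\<^sub>R u j x + (\<Sum>j\<in>I. c j *\<^sub>R u j x)) w"
    using insert.hyps by (simp add: dirichlet_form_commute)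
  also have "\<dots> = c j * dirichlet_form (u j) w + dirichlet_form (\<lambda>x. \<Sum>j\<in>I. c j *\<^sub>R u j x) w"
    using insert w by (simp add: dirichlet_form_add_left dirichlet_form_scaleR_left P1_vec_scaleR P1_vec_sum)
  finally show ?case using insert by (simp add: dirichlet_form_commute)
qed

text \<open>The diagonal mass matrix with positive weights can be inverted node by node, which
  settles uniqueness and gives an explicit candidate. The nodal formula is what later transfers
  linearity from the Dirichlet form to the discrete Laplacian.\<close>

lemma discrete_laplacian:
  assumes w: "w \<in> V"
  shows lumped_inner_discrete_laplacian: "u \<in> V \<Longrightarrow> lumped_inner \<Omega> \<T> (\<Delta> w) u = - dirichlet_form w u"
    and discrete_laplacian_node:
      "z \<in> \<N> \<Longrightarrow> \<Delta> w z $ i = - dirichlet_form w (vec_basis (z, i)) / node_weight \<Omega> \<T> z"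
proof -
  let ?P = "\<lambda>D. D \<in> V \<and> (\<forall>u\<in>V. - lumped_inner \<Omega> \<T> D u = dirichlet_form w u)"
  have node: "D z $ i = - dirichlet_form w (vec_basis (z, i)) / node_weight \<Omega> \<T> z"
    if "?P D" "z \<in> \<N>" for D z i
  proof -
    have "- lumped_inner \<Omega> \<T> D (vec_basis (z, i)) = dirichlet_form w (vec_basis (z, i))"
      using that vec_basis_P1_vec by blast
    then show ?thesis
      using lumped_inner_vec_basis[OF that(2)] node_weight_pos[OF that(2)] by (simp add: field_simps)
  qed
  have "\<exists>!D. ?P D"
  proof (rule ex_ex1I)
    \<comment> \<open>These values are forced by testing with \<open>vec_basis\<close>; the basis
      expansion of \<open>u\<close> and linearity then extend the identity to every
      \<open>u\<close>.\<close>
    let ?D = "vec_interpolant (\<lambda>z. \<chi> i. - dirichlet_form w (vec_basis (z, i)) / node_weight \<Omega> \<T> z)"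
    have "- lumped_inner \<Omega> \<T> ?D u = dirichlet_form w u" if u: "u \<in> V" for u
    proof -
      have "- lumped_inner \<Omega> \<T> ?D u = (\<Sum>z\<in>\<N>. \<Sum>i\<in>UNIV. (u z $ i) * dirichlet_form w (vec_basis (z, i)))"
        unfolding lumped_inner_def sum_negf[symmetric]
      proof (intro sum.cong refl)
        fix z assume z: "z \<in> \<N>"
        have "- (node_weight \<Omega> \<T> z * (?D z \<bullet> u z)) =
            (\<Sum>i\<in>UNIV. - (node_weight \<Omega> \<T> z * (?D z $ i * u z $ i)))"
          by (simp add: inner_vec_def sum_distrib_left sum_negf)
        also have "\<dots> = (\<Sum>i\<in>UNIV. (u z $ i) * dirichlet_form w (vec_basis (z, i)))"
          using z node_weight_pos[OF z] by (intro sum.cong) (auto simp: vec_interpolant_node)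
        finally show "- (node_weight \<Omega> \<T> z * (?D z \<bullet> u z)) =
            (\<Sum>i\<in>UNIV. (u z $ i) * dirichlet_form w (vec_basis (z, i)))" .
      qed
      also have "\<dots> = (\<Sum>s\<in>\<N> \<times> UNIV. (u (fst s) $ snd s) * dirichlet_form w (vec_basis s))"
        by (simp add: sum.cartesian_product split_beta)
      also have "\<dots> = dirichlet_form w (\<lambda>x. \<Sum>s\<in>\<N> \<times> UNIV. (u (fst s) $ snd s) *\<^sub>R vec_basis s x)"
        using finite_nodes by (intro dirichlet_form_sum_right[symmetric] w vec_basis_P1_vec) auto
      also have "\<dots> = dirichlet_form w u" by (simp flip: P1_vec_expansion[OF u])
      finally show ?thesis .
    qed
    then show "\<exists>D. ?P D" using vec_interpolant_P1_vec by blast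
  next
    fix D D' assume "?P D" "?P D'"
    then show "D = D'" using node by (intro P1_vec_eqI) (auto simp: vec_eq_iff)
  qed
  from theI'[OF this] have P: "?P (\<Delta> w)"
    by (simp add: discrete_laplacian_def dirichlet_form_def)
  then show "lumped_inner \<Omega> \<T> (\<Delta> w) u = - dirichlet_form w u" if "u \<in> V"
    using that by (metis minus_minus)
  show "\<Delta> w z $ i = - dirichlet_form w (vec_basis (z, i)) / node_weight \<Omega> \<T> z" if "z \<in> \<N>"
    using node[OF P that] .
qed

lemma discrete_laplacian_add_node:
  assumes "w \<in> V" "w' \<in> V" "z \<in> \<N>"
  shows "\<Delta> (\<lambda>x. w x + w' x) z = \<Delta> w z + \<Delta> w' z"
  using assms by (simp add: vec_eq_iff discrete_laplacian_node P1_vec_add dirichlet_form_add_left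
      vec_basis_P1_vec diff_divide_distrib)

lemma discrete_laplacian_scaleR_node:
  assumes "w \<in> V" "z \<in> \<N>"
  shows "\<Delta> (\<lambda>x. c *\<^sub>R w x) z = c *\<^sub>R \<Delta> w z"
  using assms by (simp add: vec_eq_iff discrete_laplacian_node P1_vec_scaleR dirichlet_form_scaleR_left
      vec_basis_P1_vec)

end

section \<open>Well-posedness of PC1\<close>

text \<open>
  Applying \<open>\<alpha> + m \<times> _\<close> to the nodal equation inverts \<open>\<alpha> - m \<times> _\<close> on the tangent plane, which gives
  \<open>\<alpha> v + m \<times> v = - c m \<times> (m \<times> H)\<close>; then test with \<open>v\<close>.
\<close>

lemma predictor_cross_identity:
  fixes m v H :: "real^3"
  assumes m: "norm m = 1"
    and eq: "(1 + \<alpha>\<^sup>2) *\<^sub>R v = - (c *\<^sub>R cross3 m H) - (\<alpha> * c) *\<^sub>R cross3 m (cross3 m H)"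
  shows "m \<bullet> v = 0" "\<alpha> * (v \<bullet> v) = c * (H \<bullet> v)"
proof -
  have pos: "1 + \<alpha>\<^sup>2 \<noteq> 0" by (metis add_pos_nonneg less_irrefl zero_le_power2 zero_less_one)
  have mm: "m \<bullet> m = 1" using m by (simp add: norm_eq_1)
  have "(1 + \<alpha>\<^sup>2) * (m \<bullet> v) = m \<bullet> ((1 + \<alpha>\<^sup>2) *\<^sub>R v)" by simp
  also have "\<dots> = 0" unfolding eq by (simp add: inner_diff_right dot_cross_self)
  finally show mv: "m \<bullet> v = 0" using pos by simp
  let ?P = "cross3 m (cross3 m H)"
  have mP: "cross3 m ?P = - cross3 m H"
    by (simp add: Lagrange[of m m] cross_mult_right mm)
       (simp add: cross3_simps mm)
  have "(1 + \<alpha>\<^sup>2) *\<^sub>R cross3 m v = cross3 m ((1 + \<alpha>\<^sup>2) *\<^sub>R v)" by (simp add: cross_mult_right)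
  also have "\<dots> = - (c *\<^sub>R ?P) + (\<alpha> * c) *\<^sub>R cross3 m H"
    unfolding eq by (simp add: mP cross_mult_right Cross3.right_diff_distrib)
  finally have e2: "(1 + \<alpha>\<^sup>2) *\<^sub>R cross3 m v = - (c *\<^sub>R ?P) + (\<alpha> * c) *\<^sub>R cross3 m H" .
  have "(1 + \<alpha>\<^sup>2) *\<^sub>R (\<alpha> *\<^sub>R v + cross3 m v) = \<alpha> *\<^sub>R ((1 + \<alpha>\<^sup>2) *\<^sub>R v) + (1 + \<alpha>\<^sup>2) *\<^sub>R cross3 m v"
    by (simp add: algebra_simps)
  \<comment> \<open>The terms in m x H cancel, and the double cross products combine to the factor 1
    + \<alpha>^2.\<close>
  also have "\<dots> = (1 + \<alpha>\<^sup>2) *\<^sub>R (- (c *\<^sub>R ?P))"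
    unfolding eq e2 by (simp add: algebra_simps power2_eq_square)
  finally have "\<alpha> *\<^sub>R v + cross3 m v = - (c *\<^sub>R ?P)" using pos by (simp only: scaleR_cancel_left) simp
  then have "(\<alpha> *\<^sub>R v + cross3 m v) \<bullet> v = - (c *\<^sub>R ?P) \<bullet> v" by simp
  \<comment> \<open>For a unit vector m x (m x H) = (m . H) m - H, and tangentiality of
    \<open>v\<close> removes the part along \<open>m\<close>.\<close>
  moreover have "?P \<bullet> v = - (H \<bullet> v)"
    using mv by (simp add: Lagrange mm inner_diff_left)
  ultimately show "\<alpha> * (v \<bullet> v) = c * (H \<bullet> v)"
    by (simp add: inner_add_left dot_cross_self)
qed

section \<open>The predictor as a linear system\<close>

locale PC1_step = tetrahedral_mesh +
  fixes \<alpha> l \<theta> k :: real and m :: "real^3 \<Rightarrow> real^3"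
  assumes \<alpha>: "\<alpha> > 0" and \<theta>: "0 \<le> \<theta>" and k: "0 \<le> k" and m: "m \<in> unit_P1_vec \<Omega> \<T>"
begin

lemma m_P1_vec: "m \<in> V" and m_unit: "z \<in> \<N> \<Longrightarrow> norm (m z) = 1"
  using m by (auto simp: unit_P1_vec_def)

text \<open>The sign is chosen so that the nodal predictor equation becomes
  \<open>(1 + \<alpha>\<^sup>2) *\<^sub>R v z + torque H z = 0\<close>.\<close>

definition torque :: "(real^3 \<Rightarrow> real^3) \<Rightarrow> real^3 \<Rightarrow> real^3" where
  "torque H z = l\<^sup>2 *\<^sub>R cross3 (m z) (H z) + (\<alpha> * l\<^sup>2) *\<^sub>R cross3 (m z) (cross3 (m z) (H z))"

text \<open>The cross products are not piecewise linear in general, but the lumped product sees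
  nodal values only. In one direction the positive weight is divided out; in the other every summand
  vanishes.\<close>

lemma predictor_iff_nodal:
  "PC1_predictor \<Omega> \<T> \<alpha> l \<theta> k m v \<longleftrightarrow> v \<in> V \<and>
    (\<forall>z\<in>\<N>. (1 + \<alpha>\<^sup>2) *\<^sub>R v z = - torque (\<Delta> (\<lambda>x. m x + (\<theta> * k) *\<^sub>R v x)) z)"
proof -
  define H where "H = \<Delta> (\<lambda>x. m x + (\<theta> * k) *\<^sub>R v x)"
  have "lumped_inner \<Omega> \<T> (\<lambda>z. (1 + \<alpha>\<^sup>2) *\<^sub>R v z + torque H z) w =
      (1 + \<alpha>\<^sup>2) * lumped_inner \<Omega> \<T> v w + (l\<^sup>2 * lumped_inner \<Omega> \<T> (\<lambda>x. cross3 (m x) (H x)) w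
          + \<alpha> * l\<^sup>2 * lumped_inner \<Omega> \<T> (\<lambda>x. cross3 (m x) (cross3 (m x) (H x))) w)" for w
    unfolding lumped_inner_def sum_distrib_left sum.distrib[symmetric]
    by (intro sum.cong) (simp_all add: torque_def inner_add_left algebra_simps)
  then  have "(\<forall>w\<in>V. (1 + \<alpha>\<^sup>2) * lumped_inner \<Omega> \<T> v w =
          - l\<^sup>2 * lumped_inner \<Omega> \<T> (\<lambda>x. cross3 (m x) (H x)) w
          - \<alpha> * l\<^sup>2 * lumped_inner \<Omega> \<T> (\<lambda>x. cross3 (m x) (cross3 (m x) (H x))) w) \<longleftrightarrow>
        (\<forall>w\<in>V. lumped_inner \<Omega> \<T> (\<lambda>z. (1 + \<alpha>\<^sup>2) *\<^sub>R v z + torque H z) w = 0)"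
    by (intro ball_cong refl) (simp add: algebra_simps eq_neg_iff_add_eq_0)
  also have "\<dots> \<longleftrightarrow> (\<forall>z\<in>\<N>. (1 + \<alpha>\<^sup>2) *\<^sub>R v z + torque H z = 0)"
  proof safe
    fix z assume *: "\<forall>w\<in>V. lumped_inner \<Omega> \<T> (\<lambda>z. (1 + \<alpha>\<^sup>2) *\<^sub>R v z + torque H z) w = 0" and z: "z \<in> \<N>"
    have "((1 + \<alpha>\<^sup>2) *\<^sub>R v z + torque H z) $ i = 0" for i
      using *[rule_format, OF vec_basis_P1_vec, of "(z, i)"] node_weight_pos[OF z]
      by (simp only: lumped_inner_vec_basis[OF z]) simp
    then show "(1 + \<alpha>\<^sup>2) *\<^sub>R v z + torque H z = 0" by (simp only: vec_eq_iff zero_index) simp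
  qed (simp add: lumped_inner_def)
  finally show ?thesis unfolding PC1_predictor_def Let_def H_def
    by (simp only: add_eq_0_iff2)
qed

text \<open>The part of the predictor equation that is linear in \<open>v\<close>: the implicit term
  with \<theta> k is moved to the left, and the term with \<open>\<Delta> m\<close> remains as
  data.\<close>

definition predictor_op :: "(real^3 \<Rightarrow> real^3) \<Rightarrow> real^3 \<Rightarrow> real^3" where
  "predictor_op v z = (1 + \<alpha>\<^sup>2) *\<^sub>R v z + (\<theta> * k) *\<^sub>R torque (\<Delta> v) z"

text \<open>Locality (\<open>torque_cong\<close>) matters because additivity and homogeneity of the
  discrete Laplacian have been established at nodes.\<close>

lemma torque_add: "torque (\<lambda>x. H x + H' x) z = torque H z + torque H' z"
  and torque_scaleR: "torque (\<lambda>x. c *\<^sub>R H x) z = c *\<^sub>R torque H z"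
  and torque_cong: "H z = H' z \<Longrightarrow> torque H z = torque H' z"
  by (simp_all add: torque_def Cross3.cross_add_right cross_mult_right algebra_simps)

lemma predictor_iff:
  "PC1_predictor \<Omega> \<T> \<alpha> l \<theta> k m v \<longleftrightarrow>
    v \<in> V \<and> (\<forall>z\<in>\<N>. predictor_op v z = - torque (\<Delta> m) z)"
proof -
  have "torque (\<Delta> (\<lambda>x. m x + (\<theta> * k) *\<^sub>R v x)) z = torque (\<Delta> m) z + (\<theta> * k) *\<^sub>R torque (\<Delta> v) z"
    if "v \<in> V" "z \<in> \<N>" for z
  proof -
    have "\<Delta> (\<lambda>x. m x + (\<theta> * k) *\<^sub>R v x) z = \<Delta> m z + (\<theta> * k) *\<^sub>R \<Delta> v z"
      using that m_P1_vec
      by (simp add: discrete_laplacian_add_node discrete_laplacian_scaleR_node P1_vec_scaleR)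
    then have "torque (\<Delta> (\<lambda>x. m x + (\<theta> * k) *\<^sub>R v x)) z = torque (\<lambda>z. \<Delta> m z + (\<theta> * k) *\<^sub>R \<Delta> v z) z"
      by (rule torque_cong)
    then show ?thesis by (simp only: torque_add torque_scaleR)
  qed
  then show ?thesis unfolding predictor_iff_nodal predictor_op_def
    by (auto simp: algebra_simps eq_neg_iff_add_eq_0)
qed

lemma predictor_op_add:
  assumes "v \<in> V" "v' \<in> V" "z \<in> \<N>"
  shows "predictor_op (\<lambda>x. v x + v' x) z = predictor_op v z + predictor_op v' z"
  using torque_cong[of "\<Delta> (\<lambda>x. v x + v' x)" z "\<lambda>z. \<Delta> v z + \<Delta> v' z", OF discrete_laplacian_add_node[OF assms]]
  by (simp add: predictor_op_def torque_add algebra_simps)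

lemma predictor_op_scaleR:
  assumes "v \<in> V" "z \<in> \<N>"
  shows "predictor_op (\<lambda>x. c *\<^sub>R v x) z = c *\<^sub>R predictor_op v z"
  using torque_cong[of "\<Delta> (\<lambda>x. c *\<^sub>R v x)" z "\<lambda>z. c *\<^sub>R \<Delta> v z", OF discrete_laplacian_scaleR_node[OF assms]]
  by (simp add: predictor_op_def torque_scaleR algebra_simps)

lemma predictor_op_inj:
  assumes v: "v \<in> V" and zero: "\<And>z. z \<in> \<N> \<Longrightarrow> predictor_op v z = 0" and z: "z \<in> \<N>"
  shows "v z = 0"
proof -
  let ?\<beta> = "node_weight \<Omega> \<T>"
  have "\<alpha> * (v z \<bullet> v z) = l\<^sup>2 * (((\<theta> * k) *\<^sub>R \<Delta> v z) \<bullet> v z)" if "z \<in> \<N>" for z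
  proof (rule predictor_cross_identity(2)[OF m_unit[OF that]])
    have "(1 + \<alpha>\<^sup>2) *\<^sub>R v z = - torque (\<lambda>x. (\<theta> * k) *\<^sub>R \<Delta> v x) z"
      using zero[OF that] unfolding predictor_op_def torque_scaleR by (simp only: add_eq_0_iff2)
    then show "(1 + \<alpha>\<^sup>2) *\<^sub>R v z = - (l\<^sup>2 *\<^sub>R cross3 (m z) ((\<theta> * k) *\<^sub>R \<Delta> v z)) -
        (\<alpha> * l\<^sup>2) *\<^sub>R cross3 (m z) (cross3 (m z) ((\<theta> * k) *\<^sub>R \<Delta> v z))"
      by (simp add: torque_def)
  qed
  then have "(\<Sum>z\<in>\<N>. ?\<beta> z * (\<alpha> * (v z \<bullet> v z))) = (\<Sum>z\<in>\<N>. (l\<^sup>2 * \<theta> * k) * (?\<beta> z * (\<Delta> v z \<bullet> v z)))"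
    by (intro sum.cong) auto
  also have "\<dots> = (l\<^sup>2 * \<theta> * k) * lumped_inner \<Omega> \<T> (\<Delta> v) v"
    by (simp add: lumped_inner_def sum_distrib_left)
  also have "\<dots> = - ((l\<^sup>2 * \<theta> * k) * dirichlet_form v v)"
    using lumped_inner_discrete_laplacian[OF v v] by simp
  also have "\<dots> \<le> 0"
    using dirichlet_form_nonneg[of v] \<theta> k by simp
  finally have "(\<Sum>z\<in>\<N>. ?\<beta> z * (\<alpha> * (v z \<bullet> v z))) \<le> 0" .
  moreover have nonneg: "?\<beta> z * (\<alpha> * (v z \<bullet> v z)) \<ge> 0" if "z \<in> \<N>" for z
    using \<alpha> node_weight_pos[OF that] by (intro mult_nonneg_nonneg) (simp_all add: less_imp_le)
  ultimately have "(\<Sum>z\<in>\<N>. ?\<beta> z * (\<alpha> * (v z \<bullet> v z))) = 0"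
    by (intro order.antisym sum_nonneg)
  then have "?\<beta> z * (\<alpha> * (v z \<bullet> v z)) = 0"
    using sum_nonneg_eq_0_iff[OF finite_nodes, of "\<lambda>z. ?\<beta> z * (\<alpha> * (v z \<bullet> v z))"] nonneg z by blast
  then show ?thesis using \<alpha> node_weight_pos[OF z] by simp
qed

text \<open>Coordinates \<open>x (z, i)\<close> are turned into functions by interpolation, so that
  injectivity on the finite element space becomes injectivity of a square system indexed by nodes
  and components.\<close>

lemma predictor_op_surj: "\<exists>v\<in>V. \<forall>z\<in>\<N>. predictor_op v z = b z"
proof -
  define v where "v x = vec_interpolant (\<lambda>z. \<chi> i. x (z, i))" for x :: "(real^3) \<times> 3 \<Rightarrow> real"
  have vV: "v x \<in> V" for x by (simp add: v_def vec_interpolant_P1_vec)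
  have v_node: "v x z = (\<chi> i. x (z, i))" if "z \<in> \<N>" for x z
    using that by (simp add: v_def vec_interpolant_node)
  have "\<exists>x. \<forall>s\<in>\<N> \<times> UNIV. (\<lambda>x s. predictor_op (v x) (fst s) $ snd s) x s = b (fst s) $ snd s"
  proof (rule linear_inj_imp_surj_on_finite)
    show "finite (\<N> \<times> (UNIV :: 3 set))" using finite_nodes by simp
    fix x y :: "(real^3) \<times> 3 \<Rightarrow> real" and c and s :: "(real^3) \<times> 3"
    assume s: "s \<in> \<N> \<times> UNIV"
    have "v (\<lambda>t. x t + y t) = (\<lambda>z. v x z + v y z)"
      by (intro P1_vec_eqI vV P1_vec_add) (simp add: v_node vec_eq_iff)
    then show "predictor_op (v (\<lambda>t. x t + y t)) (fst s) $ snd s =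
        predictor_op (v x) (fst s) $ snd s + predictor_op (v y) (fst s) $ snd s"
      using s by (auto simp: predictor_op_add vV)
    have "v (\<lambda>t. c * x t) = (\<lambda>z. c *\<^sub>R v x z)"
      by (intro P1_vec_eqI vV P1_vec_scaleR) (simp add: v_node vec_eq_iff)
    then show "predictor_op (v (\<lambda>t. c * x t)) (fst s) $ snd s = c * predictor_op (v x) (fst s) $ snd s"
      using s by (auto simp: predictor_op_scaleR vV)
    show "predictor_op (v x) (fst s) $ snd s = predictor_op (v y) (fst s) $ snd s"
      if "\<And>t. t \<in> \<N> \<times> UNIV \<Longrightarrow> x t = y t"
    proof -
      have "v x = v y" using that by (intro P1_vec_eqI vV) (simp add: v_node vec_eq_iff)
      then show ?thesis by simp
    qed
  next
    fix x :: "(real^3) \<times> 3 \<Rightarrow> real"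
    assume x: "\<And>s. s \<in> \<N> \<times> UNIV \<Longrightarrow> predictor_op (v x) (fst s) $ snd s = 0"
    have "v x z = 0" if "z \<in> \<N>" for z
    proof (rule predictor_op_inj[OF vV _ that])
      show "predictor_op (v x) z = 0" if "z \<in> \<N>" for z
        using x[of "(z, _)"] that by (simp add: vec_eq_iff)
    qed
    then show "\<forall>s\<in>\<N> \<times> UNIV. x s = 0" by (auto simp: v_node vec_eq_iff)
  qed
  then obtain x where "\<forall>s\<in>\<N> \<times> UNIV. predictor_op (v x) (fst s) $ snd s = b (fst s) $ snd s" by blast
  then show ?thesis using vV[of x] by (intro bexI[of _ "v x"]) (auto simp: vec_eq_iff)
qed

lemma predictor_ex1: "\<exists>!v. PC1_predictor \<Omega> \<T> \<alpha> l \<theta> k m v"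
proof (rule ex_ex1I)
  show "\<exists>v. PC1_predictor \<Omega> \<T> \<alpha> l \<theta> k m v"
    using predictor_op_surj[of "\<lambda>z. - torque (\<Delta> m) z"] predictor_iff by blast
next
  fix v v' assume "PC1_predictor \<Omega> \<T> \<alpha> l \<theta> k m v" "PC1_predictor \<Omega> \<T> \<alpha> l \<theta> k m v'"
  then have v: "v \<in> V" "v' \<in> V" "\<And>z. z \<in> \<N> \<Longrightarrow> predictor_op v z = predictor_op v' z"
    by (auto simp: predictor_iff)
  let ?d = "\<lambda>x. v x + (- 1) *\<^sub>R v' x"
  have d: "?d \<in> V" using v by (intro P1_vec_add P1_vec_scaleR)
  have "predictor_op ?d z = 0" if "z \<in> \<N>" for z
    using v that predictor_op_add[of v "\<lambda>x. (- 1) *\<^sub>R v' x" z] predictor_op_scaleR[of v' z "- 1"]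
      P1_vec_scaleR[of v' "- 1"] by simp
  from predictor_op_inj[OF d this] have "?d z = 0" if "z \<in> \<N>" for z
    using that by blast
  then show "v = v'" using v by (intro P1_vec_eqI) auto
qed

lemma predictor_orthogonal:
  assumes v: "PC1_predictor \<Omega> \<T> \<alpha> l \<theta> k m v" and z: "z \<in> \<N>"
  shows "m z \<bullet> v z = 0"
  using v z m_unit[OF z] predictor_cross_identity(1)[of "m z" \<alpha> "v z" "l\<^sup>2"]
  by (auto simp: predictor_iff_nodal torque_def)

section \<open>The corrector and the iteration over the time levels\<close>

lemma corrector_denominator:
  assumes v: "PC1_predictor \<Omega> \<T> \<alpha> l \<theta> k m v" and z: "z \<in> \<N>"
  shows "norm (m z + k *\<^sub>R v z) \<noteq> 0"
proof
  assume "norm (m z + k *\<^sub>R v z) = 0"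
  \<comment> \<open>Pairing with \<open>m z\<close> suffices: by tangentiality m . (m + k v) = 1,
    which excludes a zero vector.\<close>
  then have "m z \<bullet> (m z + k *\<^sub>R v z) = 0" by simp
  then have "m z \<bullet> m z = 0" using predictor_orthogonal[OF v z] by (simp add: inner_add_right)
  then show False using m_unit[OF z] by simp
qed

text \<open>The corrector prescribes nodal values only; interpolation provides the function, and
  nodal values determine it. Nonvanishing denominators make these values unit vectors.\<close>

lemma corrector_ex1:
  assumes v: "PC1_predictor \<Omega> \<T> \<alpha> l \<theta> k m v"
  shows "\<exists>!u. PC1_corrector \<Omega> \<T> k m v u"
proof (rule ex_ex1I)
  let ?g = "\<lambda>z. (m z + k *\<^sub>R v z) /\<^sub>R norm (m z + k *\<^sub>R v z)"
  have "vec_interpolant ?g \<in> unit_P1_vec \<Omega> \<T>"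
    using corrector_denominator[OF v] vec_interpolant_P1_vec
    by (auto simp: unit_P1_vec_def vec_interpolant_node)
  then show "\<exists>u. PC1_corrector \<Omega> \<T> k m v u"
    by (auto simp: PC1_corrector_def vec_interpolant_node)
qed (auto simp: PC1_corrector_def unit_P1_vec_def intro!: P1_vec_eqI)

end

theorem theorem3p3:
  fixes \<Omega> :: "(real^3) set" and \<T> :: "(real^3) set set"
    and h T k \<alpha> l\<^sub>e\<^sub>x \<theta> :: real and L :: nat
    and m\<^sub>0 :: "real^3 \<Rightarrow> real^3"
  assumes "bounded_lipschitz_domain \<Omega>"
    and "tetrahedral_triangulation \<Omega> \<T>" and "h = mesh_size \<T>" and "h > 0"
    and "T > 0" and "L > 0" and "k = T / real L"
    and "l\<^sub>e\<^sub>x > 0" and "0 \<le> \<theta>" and "\<theta> \<le> 1"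
    and "\<alpha> > 0"
    and "m\<^sub>0 \<in> unit_P1_vec \<Omega> \<T>"
  shows "\<exists>m v :: nat \<Rightarrow> real^3 \<Rightarrow> real^3.
     m 0 = m\<^sub>0 \<and>
     (\<forall>l < L.
        (\<exists>!u. PC1_predictor \<Omega> \<T> \<alpha> l\<^sub>e\<^sub>x \<theta> k (m l) u) \<and>
        PC1_predictor \<Omega> \<T> \<alpha> l\<^sub>e\<^sub>x \<theta> k (m l) (v l) \<and>
        (\<forall>z \<in> nodes \<T>. norm (m l z + k *\<^sub>R v l z) \<noteq> 0) \<and>
        (\<exists>!u. PC1_corrector \<Omega> \<T> k (m l) (v l) u) \<and>
        PC1_corrector \<Omega> \<T> k (m l) (v l) (m (Suc l)) \<and>
        m (Suc l) \<in> unit_P1_vec \<Omega> \<T>)"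
proof -
  \<comment> \<open>Both sequences are defined by recursion with description operators before
    well-posedness is known. \<open>pred\<close> and \<open>corr\<close> justify one step under the
    invariant \<open>m n \<in> unit_P1_vec \<Omega> \<T>\<close>, which the induction in
    \<open>unit\<close> then establishes for every \<open>n\<close>.\<close>
  define V where "V m = (THE u. PC1_predictor \<Omega> \<T> \<alpha> l\<^sub>e\<^sub>x \<theta> k m u)" for m
  define m where "m = rec_nat m\<^sub>0 (\<lambda>_ m. THE u. PC1_corrector \<Omega> \<T> k m (V m) u)"
  have m_Suc: "m (Suc n) = (THE u. PC1_corrector \<Omega> \<T> k (m n) (V (m n)) u)" for n
    by (simp add: m_def)
  have step: "PC1_step \<Omega> \<T> \<alpha> \<theta> k (m n)" if "m n \<in> unit_P1_vec \<Omega> \<T>" for n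
    using assms that by unfold_locales auto
  have pred: "PC1_predictor \<Omega> \<T> \<alpha> l\<^sub>e\<^sub>x \<theta> k (m n) (V (m n))" if "m n \<in> unit_P1_vec \<Omega> \<T>" for n
    unfolding V_def by (rule theI'[OF PC1_step.predictor_ex1[OF step[OF that]]])
  have corr: "PC1_corrector \<Omega> \<T> k (m n) (V (m n)) (m (Suc n))" if "m n \<in> unit_P1_vec \<Omega> \<T>" for n
    unfolding m_Suc by (rule theI'[OF PC1_step.corrector_ex1[OF step[OF that] pred[OF that]]])
  have unit: "m n \<in> unit_P1_vec \<Omega> \<T>" for n
  proof (induction n)
    case 0
    then show ?case using assms by (simp add: m_def)
  next
    case (Suc n)
    then show ?case using corr[of n] by (simp add: PC1_corrector_def)
  qed
  show ?thesis
  proof (rule exI[of _ m], rule exI[of _ "\<lambda>n. V (m n)"], intro conjI allI impI ballI)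
    show "m 0 = m\<^sub>0" by (simp add: m_def)
    fix n
    show "\<exists>!u. PC1_predictor \<Omega> \<T> \<alpha> l\<^sub>e\<^sub>x \<theta> k (m n) u"
      by (rule PC1_step.predictor_ex1[OF step[OF unit]])
    show "PC1_predictor \<Omega> \<T> \<alpha> l\<^sub>e\<^sub>x \<theta> k (m n) (V (m n))" by (rule pred[OF unit])
    show "\<exists>!u. PC1_corrector \<Omega> \<T> k (m n) (V (m n)) u"
      by (rule PC1_step.corrector_ex1[OF step[OF unit] pred[OF unit]])
    show "PC1_corrector \<Omega> \<T> k (m n) (V (m n)) (m (Suc n))" by (rule corr[OF unit])
    show "m (Suc n) \<in> unit_P1_vec \<Omega> \<T>" by (rule unit)
    fix z assume "z \<in> nodes \<T>"
    then show "norm (m n z + k *\<^sub>R V (m n) z) \<noteq> 0"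
      by (rule PC1_step.corrector_denominator[OF step[OF unit] pred[OF unit]])
  qed
qed

end
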